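(* Let initial states $(\hat\rho_k,\hat u_k)\in D$, $k=1,\dots,d$, be given. Then there exists a unique solution $(\rho_k,u_k)_{k=1,\dots,d}$ to the generalized Riemann problem, with a unique artificial density $\rho_*\ge 0$.
   Context: Let $\kappa>0$, $1<\gamma<3$, $\theta=\frac{\gamma-1}2$, $a_\gamma=\frac{2\sqrt{\gamma\kappa}}{\gamma-1}$, $d\in\mathbb N$, $A_1,\dots,A_d>0$, and $D=\{(\rho,u)\in\mathbb R^2:\rho>0\text{ or }\rho=u=0\}$. The isentropic gas equations are $\partial_t\rho+\partial_x(\rho u)=0$, $\partial_t(\rho u)+\partial_x(\rho u^2+\kappa\rho^\gamma)=0$, with eigenvalues $\lambda_1=u-\sqrt{\kappa\gamma}\rho^\theta$, $\lambda_2=u+\sqrt{\kappa\gamma}\rho^\theta$. Lax solution of the standard Riemann problem. For $(\rho_l,u_l),(\rho_r,u_r)\in D$, $\mathcal{RP}(\rho_l,u_l,\rho_r,u_r)(x/t)$ denotes the self-similar weak entropy solution in the sense of Lax with initial data $(\rho_l,u_l)$ for $x<0$, $(\rho_r,u_r)$ for $x>0$: the left state is joined by a 1-wave to an intermediate state, which is joined by a 2-wave to the right state. The forward wave curves through $(\rho_0,u_0)$, $\rho_0>0$, are: $\mathcal R_1$: $u=u_0+a_\gamma\rho_0^\theta-a_\gamma\rho^\theta$, $\rho<\rho_0$; $\mathcal R_2$: $u=u_0-a_\gamma\rho_0^\theta+a_\gamma\rho^\theta$, $\rho>\rho_0$ (centered rarefactions); $\mathcal S_1$ (for $\rho>\rho_0$)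 and $\mathcal S_2$ (for $\rho<\rho_0$): $u=u_0-\sqrt{\kappa(\rho^\gamma-\rho_0^\gamma)(\rho-\rho_0)/(\rho\rho_0)}$ (shocks with Rankine–Hugoniot speed). If $\rho_l,\rho_r>0$ and $u_l+a_\gamma\rho_l^\theta\le u_r-a_\gamma\rho_r^\theta$, the solution consists of a 1-rarefaction to vacuum and a 2-rarefaction from vacuum; if $\rho_l=0<\rho_r$ it is a 2-rarefaction from vacuum (speeds from $u_r-a_\gamma\rho_r^\theta$ to $\lambda_2(\rho_r,u_r)$); if $\rho_r=0<\rho_l$ it is a 1-rarefaction to vacuum (speeds from $\lambda_1(\rho_l,u_l)$ to $u_l+a_\gamma\rho_l^\theta$); if $\rho_l=\rho_r=0$ it is vacuum. Vacuum is the state $(0,0)\in D$. Generalized Riemann problem. Functions $(\rho_k,u_k)\colon(0,\infty)_t\times(0,\infty)_x\to D$, $k=1,\dots,d$, are a (weak) solution with initial data $(\hat\rho_k,\hat u_k)\in D$ if: (RP0) $(\rho_k,u_k)(0+,x)=(\hat\rho_k,\hat u_k)$ for all $x>0$ and all $k$; (RP1) there is $\rho_*\ge0$ (the artificial density, independent of $k$) such that for every $k$, $(\rho_k,u_k)$ is the restriction to $x>0$ of the Lax solution of the standard Riemann problem with data $(\rho_*,0)$ for $x<0$ and $(\hat\rho_k,\hat u_k)$ for $x>0$; (RP2) $\sum_{k=1}^dA_k\bar\rho_k\bar u_k=0$, where $(\bar\rho_k,\bar u_k)=(\rho_k,u_k)(t,0+)$ for a.e. $t>0$. *)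

theory Defs
  imports "HOL-Analysis.Analysis"
begin

type_synonym state = "real \<times> real"  \<comment> \<open>density, velocity\<close>

definition gas_states :: "state set" where
  "gas_states = {(\<rho>, u). \<rho> > 0 \<or> (\<rho> = 0 \<and> u = 0)}"

abbreviation vacuum :: state where
  "vacuum \<equiv> (0, 0)"

definition theta :: "real \<Rightarrow> real" where
  "theta \<gamma> = (\<gamma> - 1) / 2"

definition a_coeff :: "real \<Rightarrow> real \<Rightarrow> real" where
  "a_coeff \<kappa> \<gamma> = 2 * sqrt (\<gamma> * \<kappa>) / (\<gamma> - 1)"

definition lambda1 :: "real \<Rightarrow> real \<Rightarrow> state \<Rightarrow> real" where
  "lambda1 \<kappa> \<gamma> = (\<lambda>(\<rho>, u). u - sqrt (\<kappa> * \<gamma>) * \<rho> powr theta \<gamma>)"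

definition lambda2 :: "real \<Rightarrow> real \<Rightarrow> state \<Rightarrow> real" where
  "lambda2 \<kappa> \<gamma> = (\<lambda>(\<rho>, u). u + sqrt (\<kappa> * \<gamma>) * \<rho> powr theta \<gamma>)"

text \<open>Speed of the vacuum boundary of a 1-rarefaction from the given state into vacuum,
  respectively of a 2-rarefaction from vacuum to the given state.\<close>

definition vacuum_speed1 :: "real \<Rightarrow> real \<Rightarrow> state \<Rightarrow> real" where
  "vacuum_speed1 \<kappa> \<gamma> = (\<lambda>(\<rho>, u). u + a_coeff \<kappa> \<gamma> * \<rho> powr theta \<gamma>)"

definition vacuum_speed2 :: "real \<Rightarrow> real \<Rightarrow> state \<Rightarrow> real" where
  "vacuum_speed2 \<kappa> \<gamma> = (\<lambda>(\<rho>, u). u - a_coeff \<kappa> \<gamma> * \<rho> powr theta \<gamma>)"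

text \<open>Forward wave curves: the states that can be reached on the right from a given
  non-vacuum state on the left. The curves contain neither the base point nor vacuum.\<close>

definition R1 :: "real \<Rightarrow> real \<Rightarrow> state \<Rightarrow> state set" where
  "R1 \<kappa> \<gamma> = (\<lambda>(\<rho>\<^sub>0, u\<^sub>0). {(\<rho>, u). 0 < \<rho> \<and> \<rho> < \<rho>\<^sub>0 \<and>
     u = u\<^sub>0 + a_coeff \<kappa> \<gamma> * \<rho>\<^sub>0 powr theta \<gamma> - a_coeff \<kappa> \<gamma> * \<rho> powr theta \<gamma>})"

definition R2 :: "real \<Rightarrow> real \<Rightarrow> state \<Rightarrow> state set" where
  "R2 \<kappa> \<gamma> = (\<lambda>(\<rho>\<^sub>0, u\<^sub>0). {(\<rho>, u). 0 < \<rho>\<^sub>0 \<and> \<rho>\<^sub>0 < \<rho> \<and>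
     u = u\<^sub>0 - a_coeff \<kappa> \<gamma> * \<rho>\<^sub>0 powr theta \<gamma> + a_coeff \<kappa> \<gamma> * \<rho> powr theta \<gamma>})"

definition S1 :: "real \<Rightarrow> real \<Rightarrow> state \<Rightarrow> state set" where
  "S1 \<kappa> \<gamma> = (\<lambda>(\<rho>\<^sub>0, u\<^sub>0). {(\<rho>, u). 0 < \<rho>\<^sub>0 \<and> \<rho>\<^sub>0 < \<rho> \<and>
     u = u\<^sub>0 - sqrt (\<kappa> * (\<rho> powr \<gamma> - \<rho>\<^sub>0 powr \<gamma>) * (\<rho> - \<rho>\<^sub>0) / (\<rho> * \<rho>\<^sub>0))})"

definition S2 :: "real \<Rightarrow> real \<Rightarrow> state \<Rightarrow> state set" where
  "S2 \<kappa> \<gamma> = (\<lambda>(\<rho>\<^sub>0, u\<^sub>0). {(\<rho>, u). 0 < \<rho> \<and> \<rho> < \<rho>\<^sub>0 \<and>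
     u = u\<^sub>0 - sqrt (\<kappa> * (\<rho> powr \<gamma> - \<rho>\<^sub>0 powr \<gamma>) * (\<rho> - \<rho>\<^sub>0) / (\<rho> * \<rho>\<^sub>0))})"

text \<open>Rankine--Hugoniot speed, from the mass equation.\<close>

definition shock_speed :: "state \<Rightarrow> state \<Rightarrow> real" where
  "shock_speed = (\<lambda>(\<rho>\<^sub>l, u\<^sub>l) (\<rho>\<^sub>r, u\<^sub>r). (\<rho>\<^sub>r * u\<^sub>r - \<rho>\<^sub>l * u\<^sub>l) / (\<rho>\<^sub>r - \<rho>\<^sub>l))"

text \<open>Self-similar wave profiles \<open>w\<close> as functions of \<open>\<xi> = x / t\<close>. On the null set formed by
  a shock line, the profile takes the right state: this selects one representative of the
  weak solution, so that it can be compared pointwise.\<close>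

definition shock_profile :: "state \<Rightarrow> state \<Rightarrow> (real \<Rightarrow> state) \<Rightarrow> bool" where
  "shock_profile Ul Ur w \<longleftrightarrow> (\<forall>\<xi>. w \<xi> = (if \<xi> < shock_speed Ul Ur then Ul else Ur))"

definition wave1 :: "real \<Rightarrow> real \<Rightarrow> state \<Rightarrow> state \<Rightarrow> (real \<Rightarrow> state) \<Rightarrow> bool" where
  "wave1 \<kappa> \<gamma> Ul Ur w \<longleftrightarrow>
     Ur = Ul \<and> (\<forall>\<xi>. w \<xi> = Ul)
   \<or> Ur \<in> R1 \<kappa> \<gamma> Ul \<and>
       (\<forall>\<xi>\<le>lambda1 \<kappa> \<gamma> Ul. w \<xi> = Ul) \<and>
       (\<forall>\<xi>. lambda1 \<kappa> \<gamma> Ul < \<xi> \<and> \<xi> < lambda1 \<kappa> \<gamma> Ur \<longrightarrow>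
             w \<xi> \<in> R1 \<kappa> \<gamma> Ul \<and> lambda1 \<kappa> \<gamma> (w \<xi>) = \<xi>) \<and>
       (\<forall>\<xi>\<ge>lambda1 \<kappa> \<gamma> Ur. w \<xi> = Ur)
   \<or> Ur \<in> S1 \<kappa> \<gamma> Ul \<and> shock_profile Ul Ur w"

definition wave2 :: "real \<Rightarrow> real \<Rightarrow> state \<Rightarrow> state \<Rightarrow> (real \<Rightarrow> state) \<Rightarrow> bool" where
  "wave2 \<kappa> \<gamma> Ul Ur w \<longleftrightarrow>
     Ur = Ul \<and> (\<forall>\<xi>. w \<xi> = Ul)
   \<or> Ur \<in> R2 \<kappa> \<gamma> Ul \<and>
       (\<forall>\<xi>\<le>lambda2 \<kappa> \<gamma> Ul. w \<xi> = Ul) \<and>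
       (\<forall>\<xi>. lambda2 \<kappa> \<gamma> Ul < \<xi> \<and> \<xi> < lambda2 \<kappa> \<gamma> Ur \<longrightarrow>
             w \<xi> \<in> R2 \<kappa> \<gamma> Ul \<and> lambda2 \<kappa> \<gamma> (w \<xi>) = \<xi>) \<and>
       (\<forall>\<xi>\<ge>lambda2 \<kappa> \<gamma> Ur. w \<xi> = Ur)
   \<or> Ur \<in> S2 \<kappa> \<gamma> Ul \<and> shock_profile Ul Ur w"

definition rarefaction_to_vacuum :: "real \<Rightarrow> real \<Rightarrow> state \<Rightarrow> (real \<Rightarrow> state) \<Rightarrow> bool" where
  "rarefaction_to_vacuum \<kappa> \<gamma> Ul w \<longleftrightarrow>
     (\<forall>\<xi>\<le>lambda1 \<kappa> \<gamma> Ul. w \<xi> = Ul) \<and>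
     (\<forall>\<xi>. lambda1 \<kappa> \<gamma> Ul < \<xi> \<and> \<xi> < vacuum_speed1 \<kappa> \<gamma> Ul \<longrightarrow>
           w \<xi> \<in> R1 \<kappa> \<gamma> Ul \<and> lambda1 \<kappa> \<gamma> (w \<xi>) = \<xi>) \<and>
     (\<forall>\<xi>\<ge>vacuum_speed1 \<kappa> \<gamma> Ul. w \<xi> = vacuum)"

text \<open>The forward curve \<open>R2\<close> through vacuum is not defined, so the states inside a
  2-rarefaction from vacuum are those whose forward curve contains the right state.\<close>

definition rarefaction_from_vacuum :: "real \<Rightarrow> real \<Rightarrow> state \<Rightarrow> (real \<Rightarrow> state) \<Rightarrow> bool" where
  "rarefaction_from_vacuum \<kappa> \<gamma> Ur w \<longleftrightarrow>
     (\<forall>\<xi>\<le>vacuum_speed2 \<kappa> \<gamma> Ur. w \<xi> = vacuum) \<and>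
     (\<forall>\<xi>. vacuum_speed2 \<kappa> \<gamma> Ur < \<xi> \<and> \<xi> < lambda2 \<kappa> \<gamma> Ur \<longrightarrow>
           Ur \<in> R2 \<kappa> \<gamma> (w \<xi>) \<and> lambda2 \<kappa> \<gamma> (w \<xi>) = \<xi>) \<and>
     (\<forall>\<xi>\<ge>lambda2 \<kappa> \<gamma> Ur. w \<xi> = Ur)"

text \<open>The profile \<open>w\<close> consists of \<open>w1\<close>, which has reached the state \<open>Um\<close> at some speed
  \<open>\<sigma>\<close>, followed by \<open>w2\<close>, which has not yet left \<open>Um\<close> at that speed.\<close>

definition join_profiles ::
    "state \<Rightarrow> (real \<Rightarrow> state) \<Rightarrow> (real \<Rightarrow> state) \<Rightarrow> (real \<Rightarrow> state) \<Rightarrow> bool" where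
  "join_profiles Um w1 w2 w \<longleftrightarrow>
     (\<exists>\<sigma>. (\<forall>\<xi>\<ge>\<sigma>. w1 \<xi> = Um) \<and> (\<forall>\<xi>\<le>\<sigma>. w2 \<xi> = Um) \<and>
          (\<forall>\<xi>. w \<xi> = (if \<xi> \<le> \<sigma> then w1 \<xi> else w2 \<xi>)))"

text \<open>\<open>lax_solution \<kappa> \<gamma> Ul Ur w\<close>: the Lax solution of the standard Riemann problem with
  left state \<open>Ul\<close> and right state \<open>Ur\<close> is \<open>(t, x) \<mapsto> w (x / t)\<close>.\<close>

inductive lax_solution :: "real \<Rightarrow> real \<Rightarrow> state \<Rightarrow> state \<Rightarrow> (real \<Rightarrow> state) \<Rightarrow> bool"
  for \<kappa> \<gamma> :: real where
  vacuum_only: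
    "lax_solution \<kappa> \<gamma> vacuum vacuum (\<lambda>\<xi>. vacuum)"
| left_vacuum:
    "fst Ur > 0 \<Longrightarrow> rarefaction_from_vacuum \<kappa> \<gamma> Ur w \<Longrightarrow> lax_solution \<kappa> \<gamma> vacuum Ur w"
| right_vacuum:
    "fst Ul > 0 \<Longrightarrow> rarefaction_to_vacuum \<kappa> \<gamma> Ul w \<Longrightarrow> lax_solution \<kappa> \<gamma> Ul vacuum w"
| middle_vacuum:
    "fst Ul > 0 \<Longrightarrow> fst Ur > 0 \<Longrightarrow> vacuum_speed1 \<kappa> \<gamma> Ul \<le> vacuum_speed2 \<kappa> \<gamma> Ur \<Longrightarrow>
     rarefaction_to_vacuum \<kappa> \<gamma> Ul w1 \<Longrightarrow> rarefaction_from_vacuum \<kappa> \<gamma> Ur w2 \<Longrightarrow>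
     join_profiles vacuum w1 w2 w \<Longrightarrow> lax_solution \<kappa> \<gamma> Ul Ur w"
| no_vacuum:
    "fst Ul > 0 \<Longrightarrow> fst Ur > 0 \<Longrightarrow> vacuum_speed1 \<kappa> \<gamma> Ul > vacuum_speed2 \<kappa> \<gamma> Ur \<Longrightarrow>
     wave1 \<kappa> \<gamma> Ul Um w1 \<Longrightarrow> wave2 \<kappa> \<gamma> Um Ur w2 \<Longrightarrow>
     join_profiles Um w1 w2 w \<Longrightarrow> lax_solution \<kappa> \<gamma> Ul Ur w"

text \<open>Candidates for solutions are families indexed by \<open>k \<in> {1..d}\<close> of maps from the open
  quadrant (arguments in the order \<open>(t, x)\<close>) to the state space. They are extensional,
  so that equality in HOL is equality on the domain.\<close>

definition grp_functions :: "nat \<Rightarrow> (nat \<Rightarrow> real \<times> real \<Rightarrow> state) set" where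
  "grp_functions d = {1..d} \<rightarrow>\<^sub>E (({0<..} \<times> {0<..}) \<rightarrow>\<^sub>E gas_states)"

definition attains_initial_data ::
    "nat \<Rightarrow> (nat \<Rightarrow> state) \<Rightarrow> (nat \<Rightarrow> real \<times> real \<Rightarrow> state) \<Rightarrow> bool" where
  "attains_initial_data d Uinit U \<longleftrightarrow>
     (\<forall>k\<in>{1..d}. \<forall>x>0. ((\<lambda>t. U k (t, x)) \<longlongrightarrow> Uinit k) (at_right 0))"

definition artificial_density ::
    "real \<Rightarrow> real \<Rightarrow> nat \<Rightarrow> (nat \<Rightarrow> state) \<Rightarrow> (nat \<Rightarrow> real \<times> real \<Rightarrow> state) \<Rightarrow> real \<Rightarrow> bool" where
  "artificial_density \<kappa> \<gamma> d Uinit U \<rho>s \<longleftrightarrow> \<rho>s \<ge> 0 \<and>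
     (\<forall>k\<in>{1..d}. \<exists>w. lax_solution \<kappa> \<gamma> (\<rho>s, 0) (Uinit k) w \<and>
                    (\<forall>t>0. \<forall>x>0. U k (t, x) = w (x / t)))"

definition conserves_mass ::
    "nat \<Rightarrow> (nat \<Rightarrow> real) \<Rightarrow> (nat \<Rightarrow> real \<times> real \<Rightarrow> state) \<Rightarrow> bool" where
  "conserves_mass d A U \<longleftrightarrow>
     (\<exists>Ubar :: nat \<Rightarrow> state.
        (\<forall>k\<in>{1..d}. AE t in lborel. t > 0 \<longrightarrow> ((\<lambda>x. U k (t, x)) \<longlongrightarrow> Ubar k) (at_right 0)) \<and>
        (\<Sum>k=1..d. A k * fst (Ubar k) * snd (Ubar k)) = 0)"

definition grp_solution ::
    "real \<Rightarrow> real \<Rightarrow> nat \<Rightarrow> (nat \<Rightarrow> real) \<Rightarrow> (nat \<Rightarrow> state) \<Rightarrow>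
     (nat \<Rightarrow> real \<times> real \<Rightarrow> state) \<Rightarrow> bool" where
  "grp_solution \<kappa> \<gamma> d A Uinit U \<longleftrightarrow>
     U \<in> grp_functions d \<and>
     attains_initial_data d Uinit U \<and>
     (\<exists>\<rho>s. artificial_density \<kappa> \<gamma> d Uinit U \<rho>s) \<and>
     conserves_mass d A U"

end

theory Submission
  imports Defs
begin

text \<open>For every edge the mass flux at \<open>x = 0+\<close> is a function of the artificial density \<open>s\<close>.
  The intermediate density \<open>m\<close> of the Riemann problem with left state \<open>(s, 0)\<close> depends
  continuously and monotonically on \<open>s\<close>. If the intermediate velocity is nonnegative, the flux
  is \<open>max m \<rho>' * min u u'\<close> with \<open>(\<rho>', u')\<close> the sonic state of the 1-rarefaction from
  \<open>(s, 0)\<close>, and this strictly increases in \<open>s\<close>; otherwise the flux is a nondecreasing negative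
  function of \<open>m\<close>. The flux is therefore continuous, nonpositive at \<open>s = 0\<close>, nonnegative for
  large \<open>s\<close>, nondecreasing, and strictly increasing wherever it is nonnegative. The
  \<open>A\<close>-weighted sum of the fluxes thus has a zero, and exactly one, since at a zero some
  summand is nonnegative. Supersonic inflow makes single fluxes, but never the sum at its zero,
  insensitive to \<open>s\<close>.\<close>

text \<open>The trace at \<open>x = 0+\<close> need not be the intermediate state, since a wave may
  straddle the axis. The intermediate velocity \<open>u\<close> decides which one can: the 1-wave is
  completed at speeds below \<open>u\<close>, the 2-wave begins at speeds above \<open>u\<close>. So
  for \<open>u \<ge> 0\<close> only the 1-wave matters, for \<open>u < 0\<close> only the 2-wave. As
  the left state is at rest, a 1-shock would force \<open>u < 0\<close>; for
  \<open>u \<ge> 0\<close> the 1-wave is thus a rarefaction, whose trace is the denser of the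
  intermediate and the sonic state. Density and velocity vary oppositely along it, which is why the
  flux is a maximum times a minimum. For \<open>u < 0\<close>, monotonicity in \<open>m\<close>
  rests on two facts: the derivative of the flux along the 2-rarefaction curve is the characteristic
  speed, and the chord slope of the flux along the 2-shock curve is the shock speed. Uniqueness is
  claimed for functions, not only for densities, so the relational definition of Lax solutions must
  be shown to admit exactly one profile.\<close>

locale isentropic_gas =
  fixes \<kappa> \<gamma> :: real
  assumes kappa_pos: "0 < \<kappa>" and gamma_gt_1: "1 < \<gamma>"
begin

section \<open>Constants of the gas law, the sonic density and the wave curves\<close>

abbreviation \<theta> :: real where "\<theta> \<equiv> theta \<gamma>"
abbreviation a :: real where "a \<equiv> a_coeff \<kappa> \<gamma>"
abbreviation c :: real where "c \<equiv> sqrt (\<kappa> * \<gamma>)"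

lemma theta_pos: "0 < \<theta>"
  using gamma_gt_1 by (simp add: theta_def)

lemma c_pos: "0 < c"
  using kappa_pos gamma_gt_1 by simp

lemma a_pos: "0 < a"
  using kappa_pos gamma_gt_1 by (simp add: a_coeff_def)

text \<open>The Riemann invariant \<open>u + a * \<rho> powr \<theta>\<close> (1-curve) or
  \<open>u - a * \<rho> powr \<theta>\<close> (2-curve) is constant in a rarefaction; eliminating
  \<open>u\<close> from the characteristic speed leaves the coefficient
  \<open>a + c\<close>.\<close>

definition b :: real where "b = a + c"

lemma b_pos: "0 < b"
  unfolding b_def using a_pos c_pos by linarith

text \<open>Makes the derivative of the mass flux along a 2-rarefaction curve equal to the
  characteristic speed, see \<open>curve_flux_mono\<close>.\<close>

lemma a_theta: "a * \<theta> = c"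
  using gamma_gt_1 by (simp add: a_coeff_def theta_def mult.commute field_simps)

lemma powr_theta_less: "0 \<le> x \<Longrightarrow> x < y \<Longrightarrow> x powr \<theta> < y powr \<theta>"
  using theta_pos by (rule powr_less_mono2)

lemma powr_theta_le: "0 \<le> x \<Longrightarrow> x \<le> y \<Longrightarrow> x powr \<theta> \<le> y powr \<theta>"
  using theta_pos by (intro powr_mono2) auto

lemma powr_gamma_less: "0 \<le> x \<Longrightarrow> x < y \<Longrightarrow> x powr \<gamma> < y powr \<gamma>"
  using gamma_gt_1 by (intro powr_less_mono2) auto

lemma powr_gamma_le: "0 \<le> x \<Longrightarrow> x \<le> y \<Longrightarrow> x powr \<gamma> \<le> y powr \<gamma>"
  using gamma_gt_1 by (intro powr_mono2) auto

text \<open>In a rarefaction fan with vacuum edge \<open>v\<close> the characteristic speed of the state of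
  density \<open>\<rho>\<close> is \<open>v \<mp> b * \<rho> powr \<theta>\<close>; \<open>sonic y\<close> is the density with speed offset \<open>y\<close>.\<close>

definition sonic :: "real \<Rightarrow> real" where
  "sonic y = (max 0 y / b) powr (1 / \<theta>)"

lemma sonic_nonneg [simp]: "0 \<le> sonic y"
  by (simp add: sonic_def)

lemma sonic_powr: "sonic y powr \<theta> = max 0 y / b"
  using theta_pos b_pos by (simp add: sonic_def powr_powr)

lemma less_sonic_iff: "0 \<le> x \<Longrightarrow> x < sonic y \<longleftrightarrow> b * x powr \<theta> < y"
proof -
  assume x: "0 \<le> x"
  have "x < sonic y \<longleftrightarrow> x powr \<theta> < sonic y powr \<theta>"
    using powr_theta_less[of x "sonic y"] powr_theta_le[of "sonic y" x] x by fastforce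
  also have "\<dots> \<longleftrightarrow> b * x powr \<theta> < max 0 y"
    using b_pos by (simp add: sonic_powr field_simps)
  also have "\<dots> \<longleftrightarrow> b * x powr \<theta> < y"
    using mult_nonneg_nonneg[OF less_imp_le[OF b_pos] powr_ge_zero[of x \<theta>]] by linarith
  finally show ?thesis .
qed

lemma sonic_pos_iff [simp]: "0 < sonic y \<longleftrightarrow> 0 < y"
  using less_sonic_iff[of 0 y] theta_pos by simp

lemma sonic_eq: "0 \<le> x \<Longrightarrow> b * x powr \<theta> = y \<Longrightarrow> sonic y = x"
proof -
  assume "0 \<le> x" "b * x powr \<theta> = y"
  then have "max 0 y / b = x powr \<theta>"
    using b_pos by (auto simp: field_simps)
  then show ?thesis
    using theta_pos \<open>0 \<le> x\<close> by (simp add: sonic_def powr_powr)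
qed

lemma continuous_on_sonic [continuous_intros]:
  "continuous_on S f \<Longrightarrow> continuous_on S (\<lambda>x. sonic (f x))"
  unfolding sonic_def using theta_pos b_pos
  by (intro continuous_on_powr' continuous_intros) auto

lemma continuous_on_powr_theta [continuous_intros]:
  "continuous_on S f \<Longrightarrow> (\<And>x. x \<in> S \<Longrightarrow> 0 \<le> f x) \<Longrightarrow> continuous_on S (\<lambda>x. f x powr \<theta>)"
  using theta_pos by (intro continuous_on_powr' continuous_intros) auto

lemma continuous_on_powr_gamma [continuous_intros]:
  "continuous_on S f \<Longrightarrow> (\<And>x. x \<in> S \<Longrightarrow> 0 \<le> f x) \<Longrightarrow> continuous_on S (\<lambda>x. f x powr \<gamma>)"
  using gamma_gt_1 by (intro continuous_on_powr' continuous_intros) auto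

text \<open>The forward 1-curve through \<open>(\<rho>\<^sub>0, u\<^sub>0)\<close> is \<open>u = u\<^sub>0 - jump \<rho>\<^sub>0 \<rho>\<close>, and the backward
  2-curve, formed by the left states of 2-waves with right state \<open>(\<rho>\<^sub>0, u\<^sub>0)\<close>, is
  \<open>u = u\<^sub>0 + jump \<rho>\<^sub>0 \<rho>\<close>.\<close>

definition jump :: "real \<Rightarrow> real \<Rightarrow> real" where
  "jump r0 r = (if r \<le> r0 then a * (r powr \<theta> - r0 powr \<theta>)
     else sqrt (\<kappa> * (r powr \<gamma> - r0 powr \<gamma>) * (r - r0) / (r * r0)))"

text \<open>For \<open>p < q\<close> both factors on the right increase in \<open>q\<close> and
  decrease in \<open>p\<close>, so the shock curves are monotone in either density without any
  differentiation.\<close>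

lemma shock_arg:
  "0 < p \<Longrightarrow> 0 < q \<Longrightarrow> \<kappa> * (q powr \<gamma> - p powr \<gamma>) * (q - p) / (q * p)
     = \<kappa> * ((q powr \<gamma> - p powr \<gamma>) * (1 / p - 1 / q))"
  for p q :: real
  by (simp add: field_simps)

lemma jump_shock:
  "0 < r0 \<Longrightarrow> r0 < r \<Longrightarrow> jump r0 r = sqrt (\<kappa> * ((r powr \<gamma> - r0 powr \<gamma>) * (1 / r0 - 1 / r)))"
  by (simp add: jump_def shock_arg)

lemma jump_zero [simp]: "0 \<le> r0 \<Longrightarrow> jump r0 0 = - a * r0 powr \<theta>"
  by (simp add: jump_def theta_pos)

lemma jump_self [simp]: "jump r0 r0 = 0"
  by (simp add: jump_def)

lemma jump_pos: "0 < r0 \<Longrightarrow> r0 < r \<Longrightarrow> 0 < jump r0 r"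
  using kappa_pos powr_gamma_less[of r0 r]
  by (auto simp: jump_shock frac_less2 intro!: mult_pos_pos)

text \<open>Densities on one branch are compared factor by factor; across \<open>r0\<close> signs
  suffice, as the rarefaction branch is nonpositive and the shock branch positive.\<close>

lemma jump_strict_mono:
  assumes "0 < r0" "0 \<le> r" "r < r'"
  shows "jump r0 r < jump r0 r'"
proof -
  consider "r' \<le> r0" | "r \<le> r0" "r0 < r'" | "r0 < r" by linarith
  then show ?thesis
  proof cases
    case 1
    then show ?thesis
      using assms a_pos powr_theta_less[of r r'] by (simp add: jump_def)
  next
    case 2
    then have "jump r0 r \<le> 0"
      using assms a_pos powr_theta_le[of r r0] by (simp add: jump_def mult_le_0_iff)
    then show ?thesis
      using jump_pos[of r0 r'] assms 2 by linarith
  next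
    case 3
    have "(r powr \<gamma> - r0 powr \<gamma>) * (1 / r0 - 1 / r)
        < (r' powr \<gamma> - r0 powr \<gamma>) * (1 / r0 - 1 / r')"
      using 3 assms powr_gamma_less[of r0 r] powr_gamma_less[of r r']
      by (intro mult_strict_mono') (auto simp: frac_le divide_strict_left_mono)
    then show ?thesis
      using 3 assms kappa_pos by (simp add: jump_shock)
  qed
qed

lemma jump_mono: "0 < r0 \<Longrightarrow> 0 \<le> r \<Longrightarrow> r \<le> r' \<Longrightarrow> jump r0 r \<le> jump r0 r'"
  using jump_strict_mono[of r0 r r'] by (cases "r = r'") auto

lemma jump_strict_antimono:
  assumes "0 \<le> r" "0 < r0" "r0 < r0'"
  shows "jump r0' r < jump r0 r"
proof -
  consider "r \<le> r0" | "r0 < r" "r \<le> r0'" | "r0' < r" by linarith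
  then show ?thesis
  proof cases
    case 1
    then show ?thesis
      using assms a_pos powr_theta_less[of r0 r0'] by (simp add: jump_def)
  next
    case 2
    then have "jump r0' r \<le> 0"
      using assms a_pos powr_theta_le[of r r0'] by (simp add: jump_def mult_le_0_iff)
    then show ?thesis
      using jump_pos[of r0 r] assms 2 by linarith
  next
    case 3
    have "(r powr \<gamma> - r0' powr \<gamma>) * (1 / r0' - 1 / r)
        < (r powr \<gamma> - r0 powr \<gamma>) * (1 / r0 - 1 / r)"
      using 3 assms powr_gamma_less[of r0 r0'] powr_gamma_less[of r0' r]
      by (intro mult_strict_mono') (auto simp: frac_le divide_strict_left_mono)
    then show ?thesis
      using 3 assms kappa_pos by (simp add: jump_shock)
  qed
qed

lemma continuous_on_jump:
  assumes "0 < r0"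
  shows "continuous_on {0..} (jump r0)"
proof -
  \<comment> \<open>Clamping at \<open>r0\<close> makes each branch vanish where the other is
    active, so the sum is continuous with no gluing argument.\<close>
  have "jump r0 r = a * (min r r0 powr \<theta> - r0 powr \<theta>) +
      sqrt (\<kappa> * (max r r0 powr \<gamma> - r0 powr \<gamma>) * (max r r0 - r0) / (max r r0 * r0))" for r
    by (simp add: jump_def min_def max_def)
  then have eq: "jump r0 = (\<lambda>r. a * (min r r0 powr \<theta> - r0 powr \<theta>) +
      sqrt (\<kappa> * (max r r0 powr \<gamma> - r0 powr \<gamma>) * (max r r0 - r0) / (max r r0 * r0)))"
    by blast
  show ?thesis
    unfolding eq using assms by (intro continuous_intros) auto
qed

text \<open>The case \<open>r = 0\<close> is separate because the clamped formula divides by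
  \<open>r\<close>.\<close>

lemma continuous_on_jump_base:
  assumes "0 \<le> r"
  shows "continuous_on {0<..} (\<lambda>s. jump s r)"
proof (cases "r = 0")
  case True
  have "continuous_on {0<..} (\<lambda>s. - a * s powr \<theta>)"
    by (intro continuous_intros) auto
  then show ?thesis
    by (rule continuous_on_eq) (use True in auto)
next
  case False
  have "continuous_on {0<..} (\<lambda>s. a * (r powr \<theta> - max r s powr \<theta>) +
      sqrt (\<kappa> * (r powr \<gamma> - min r s powr \<gamma>) * (r - min r s) / (r * min r s)))"
    using assms False by (intro continuous_intros) auto
  then show ?thesis
    by (rule continuous_on_eq) (auto simp: jump_def min_def max_def)
qed

lemma jump_unbounded:
  assumes "0 < r0"
  obtains R where "\<And>r. R \<le> r \<Longrightarrow> K < jump r0 r" "R > r0"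
proof -
  define z where "z = \<bar>K\<bar> + 1"
  \<comment> \<open>The first bound gives \<open>1 / r0 - 1 / R \<ge> 1 / (2 * r0)\<close>, the
    second gives \<open>R powr \<gamma> - r0 powr \<gamma> \<ge> z\<^sup>2 * (2 * r0) /
    \<kappa>\<close>; the radicand of the jump is then at least \<open>z\<^sup>2\<close>.\<close>
  define R where "R = max (2 * r0) ((r0 powr \<gamma> + z\<^sup>2 * (2 * r0) / \<kappa>) powr (1 / \<gamma>))"
  have R: "r0 < R" "2 * r0 \<le> R" using assms by (auto simp: R_def)
  have "r0 powr \<gamma> + z\<^sup>2 * (2 * r0) / \<kappa> \<ge> 0"
    using assms kappa_pos by simp
  then have "r0 powr \<gamma> + z\<^sup>2 * (2 * r0) / \<kappa>
      = ((r0 powr \<gamma> + z\<^sup>2 * (2 * r0) / \<kappa>) powr (1 / \<gamma>)) powr \<gamma>"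
    using gamma_gt_1 by (simp add: powr_powr)
  also have "\<dots> \<le> R powr \<gamma>"
    by (intro powr_gamma_le) (auto simp: R_def)
  finally have 1: "z\<^sup>2 * (2 * r0) / \<kappa> \<le> R powr \<gamma> - r0 powr \<gamma>" by simp
  have 2: "1 / (2 * r0) \<le> 1 / r0 - 1 / R"
    using R assms by (simp add: field_simps)
  have "z\<^sup>2 = \<kappa> * ((z\<^sup>2 * (2 * r0) / \<kappa>) * (1 / (2 * r0)))"
    using assms kappa_pos by simp
  also have "\<dots> \<le> \<kappa> * ((R powr \<gamma> - r0 powr \<gamma>) * (1 / r0 - 1 / R))"
    using 1 2 kappa_pos assms powr_gamma_le[of r0 R] R
    by (intro mult_left_mono mult_mono) auto
  finally have "z \<le> jump r0 R"
    using R assms by (simp add: jump_shock real_le_rsqrt)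
  then have K: "K < jump r0 R" by (simp add: z_def)
  show ?thesis
  proof
    show "K < jump r0 r" if "R \<le> r" for r
      using jump_mono[of r0 R r] that K R assms by linarith
    show "R > r0" by fact
  qed
qed

lemma jump_base_unbounded:
  assumes "0 \<le> r"
  obtains S where "0 < S" "\<And>s. S \<le> s \<Longrightarrow> jump s r < K"
proof -
  define y where "y = \<bar>a * r powr \<theta> - K\<bar> / a + 1"
  \<comment> \<open>Beyond \<open>r\<close> the rarefaction branch applies, and beyond
    \<open>y powr (1 / \<theta>)\<close> the term \<open>a * s powr \<theta>\<close> exceeds
    \<open>a * r powr \<theta> - K\<close>.\<close>
  define S where "S = max (r + 1) (y powr (1 / \<theta>))"
  have y: "y > 0" using a_pos by (simp add: y_def add_nonneg_pos)
  have "jump s r < K" if "S \<le> s" for s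
  proof -
    have "y = (y powr (1 / \<theta>)) powr \<theta>"
      using y theta_pos by (simp add: powr_powr)
    also have "\<dots> \<le> s powr \<theta>"
      using that by (intro powr_theta_le) (auto simp: S_def)
    finally have "a * y \<le> a * s powr \<theta>" using a_pos by simp
    moreover have "a * y = \<bar>a * r powr \<theta> - K\<bar> + a"
      using a_pos by (simp add: y_def field_simps)
    ultimately have "a * r powr \<theta> - K < a * s powr \<theta>"
      using a_pos by linarith
    moreover have "r \<le> s" using that by (simp add: S_def)
    ultimately show ?thesis by (simp add: jump_def algebra_simps)
  qed
  moreover have "0 < S" using assms by (simp add: S_def)
  ultimately show ?thesis using that by blast
qed

text \<open>The base point \<open>0\<close> behaves like an infinitely strong shock.\<close>

lemma eventually_jump_gt:
  assumes "0 < r"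
  shows "\<forall>\<^sub>F s in at_right 0. K < jump s r"
proof -
  define z where "z = \<bar>K\<bar> + 1"
  \<comment> \<open>With denominators cleared, the inequality \<open>z\<^sup>2 <\<close> radicand
    compares expressions that are continuous up to \<open>s = 0\<close>, and it is strict
    there.\<close>
  have "continuous_on {0..} (\<lambda>s. \<kappa> * (r powr \<gamma> - s powr \<gamma>) * (r - s) - z\<^sup>2 * (r * s))"
    by (intro continuous_intros) auto
  then have "((\<lambda>s. \<kappa> * (r powr \<gamma> - s powr \<gamma>) * (r - s) - z\<^sup>2 * (r * s))
      \<longlongrightarrow> \<kappa> * (r powr \<gamma> - 0 powr \<gamma>) * (r - 0) - z\<^sup>2 * (r * 0)) (at 0 within {0..})"
    unfolding continuous_on_def by (rule bspec) auto
  then have "((\<lambda>s. \<kappa> * (r powr \<gamma> - s powr \<gamma>) * (r - s) - z\<^sup>2 * (r * s))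
      \<longlongrightarrow> \<kappa> * (r powr \<gamma> - 0 powr \<gamma>) * (r - 0) - z\<^sup>2 * (r * 0)) (at_right 0)"
    by (rule tendsto_within_subset) auto
  moreover have "0 < \<kappa> * (r powr \<gamma> - 0 powr \<gamma>) * (r - 0) - z\<^sup>2 * (r * 0)"
    using assms kappa_pos by simp
  ultimately have "\<forall>\<^sub>F s in at_right 0. 0 < \<kappa> * (r powr \<gamma> - s powr \<gamma>) * (r - s) - z\<^sup>2 * (r * s)"
    by (rule order_tendstoD)
  moreover have "\<forall>\<^sub>F s in at_right 0. s \<in> {0<..<r}"
    using assms by (rule eventually_at_right_real)
  ultimately show ?thesis
  proof eventually_elim
    case (elim s)
    then have "z\<^sup>2 < \<kappa> * (r powr \<gamma> - s powr \<gamma>) * (r - s) / (r * s)"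
      using assms by (simp add: field_simps)
    then have "z < jump s r"
      using elim by (simp add: jump_def real_less_rsqrt)
    then show ?case by (simp add: z_def)
  qed
qed

lemma sonic_eq_0: "y \<le> 0 \<Longrightarrow> sonic y = 0"
  by (simp add: sonic_def max_absorb1)

lemma sonic_le_iff: "0 \<le> x \<Longrightarrow> sonic y \<le> x \<longleftrightarrow> y \<le> b * x powr \<theta>"
  using less_sonic_iff[of x y] by linarith

text \<open>Positivity of \<open>x\<close> matters: since \<open>sonic\<close> is truncated at 0,
  the left side always holds at \<open>x = 0\<close>, whereas the right side asks for
  \<open>0 \<le> y\<close>.\<close>

lemma le_sonic_iff:
  assumes "0 < x"
  shows "x \<le> sonic y \<longleftrightarrow> b * x powr \<theta> \<le> y"
proof
  assume "x \<le> sonic y"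
  then have "x powr \<theta> \<le> max 0 y / b" "0 < y"
    using assms powr_theta_le[of x "sonic y"] sonic_pos_iff[of y]
    by (auto simp: sonic_powr simp del: sonic_pos_iff)
  then show "b * x powr \<theta> \<le> y"
    using b_pos by (simp add: field_simps max_def)
next
  assume "b * x powr \<theta> \<le> y"
  then show "x \<le> sonic y"
    using less_sonic_iff[of x y] sonic_eq[of x y] assms by (cases "b * x powr \<theta> = y") auto
qed

section \<open>Explicit profiles of single waves\<close>

lemma mem_R1_iff:
  "(r, u) \<in> R1 \<kappa> \<gamma> (r0, u0) \<longleftrightarrow> 0 < r \<and> r < r0 \<and> u = u0 - jump r0 r"
  by (auto simp: R1_def jump_def algebra_simps)

lemma mem_S1_iff:
  "(r, u) \<in> S1 \<kappa> \<gamma> (r0, u0) \<longleftrightarrow> 0 < r0 \<and> r0 < r \<and> u = u0 - jump r0 r"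
  by (auto simp: S1_def jump_def)

lemma mem_R2_iff:
  "(r0, u0) \<in> R2 \<kappa> \<gamma> (r, u) \<longleftrightarrow> 0 < r \<and> r < r0 \<and> u = u0 + jump r0 r"
  by (auto simp: R2_def jump_def algebra_simps)

text \<open>The radicand is symmetric in the two densities, so reading the forward 2-shock curve
  backward only flips the sign of the root.\<close>

lemma mem_S2_iff:
  "(r0, u0) \<in> S2 \<kappa> \<gamma> (r, u) \<longleftrightarrow> 0 < r0 \<and> r0 < r \<and> u = u0 + jump r0 r"
proof -
  have "\<kappa> * (r0 powr \<gamma> - r powr \<gamma>) * (r0 - r) / (r0 * r)
      = \<kappa> * (r powr \<gamma> - r0 powr \<gamma>) * (r - r0) / (r * r0)"
    by (simp add: algebra_simps)
  then show ?thesis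
    by (auto simp: S2_def jump_def)
qed

text \<open>At density 0 the velocity formula would return the edge speed \<open>v\<close>, while
  the vacuum state carries velocity 0.\<close>

definition fan_state :: "real \<Rightarrow> real \<Rightarrow> real \<Rightarrow> state" where
  "fan_state v k r = (if r = 0 then vacuum else (r, v + k * r powr \<theta>))"

text \<open>Clamping the sonic density between the end densities \<open>m\<close> and
  \<open>rl\<close> extends the fan by its constant end states.\<close>

definition fan1 :: "real \<Rightarrow> real \<Rightarrow> real \<Rightarrow> real \<Rightarrow> state" where
  "fan1 v m rl \<xi> = fan_state v (- a) (max m (min rl (sonic (v - \<xi>))))"

definition fan2 :: "real \<Rightarrow> real \<Rightarrow> real \<Rightarrow> real \<Rightarrow> state" where
  "fan2 v m rr \<xi> = fan_state v a (max m (min rr (sonic (\<xi> - v))))"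

text \<open>Inside the fan the speed determines the density, hence the state. Allowing
  \<open>m = 0\<close> lets one statement serve both 1-rarefactions to vacuum and those to a
  positive density.\<close>

lemma fan1_iff:
  assumes "0 \<le> m" "m < rl" and v: "v = ul + a * rl powr \<theta>"
  shows "(\<forall>\<xi>\<le>lambda1 \<kappa> \<gamma> (rl, ul). w \<xi> = (rl, ul)) \<and>
    (\<forall>\<xi>. lambda1 \<kappa> \<gamma> (rl, ul) < \<xi> \<and> \<xi> < v - b * m powr \<theta> \<longrightarrow>
       w \<xi> \<in> R1 \<kappa> \<gamma> (rl, ul) \<and> lambda1 \<kappa> \<gamma> (w \<xi>) = \<xi>) \<and>
    (\<forall>\<xi>\<ge>v - b * m powr \<theta>. w \<xi> = fan_state v (- a) m) \<longleftrightarrow> w = fan1 v m rl"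
    (is "?L \<and> ?M \<and> ?R \<longleftrightarrow> _")
proof -
  have l: "lambda1 \<kappa> \<gamma> (rl, ul) = v - b * rl powr \<theta>"
    by (simp add: lambda1_def v b_def algebra_simps)
  have left: "fan1 v m rl \<xi> = (rl, ul)" if "\<xi> \<le> v - b * rl powr \<theta>" for \<xi>
  proof -
    have "rl \<le> sonic (v - \<xi>)"
      using that assms by (subst le_sonic_iff) auto
    then show ?thesis
      using assms by (simp add: fan1_def fan_state_def max_def min_def)
  qed
  have right: "fan1 v m rl \<xi> = fan_state v (- a) m" if "\<xi> \<ge> v - b * m powr \<theta>" for \<xi>
  proof -
    have "sonic (v - \<xi>) \<le> m"
      using that assms by (subst sonic_le_iff) auto
    then show ?thesis
      using assms by (simp add: fan1_def max_def min_def)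
  qed
  have mid: "y \<in> R1 \<kappa> \<gamma> (rl, ul) \<and> lambda1 \<kappa> \<gamma> y = \<xi> \<longleftrightarrow> y = fan1 v m rl \<xi>"
    if "v - b * rl powr \<theta> < \<xi>" "\<xi> < v - b * m powr \<theta>" for \<xi> y
  proof -
    have s: "m < sonic (v - \<xi>)" "sonic (v - \<xi>) < rl"
      using that assms less_sonic_iff[of m "v - \<xi>"] le_sonic_iff[of rl "v - \<xi>"] by auto
    then have f: "fan1 v m rl \<xi> = (sonic (v - \<xi>), v - a * sonic (v - \<xi>) powr \<theta>)"
      using assms by (simp add: fan1_def fan_state_def max_def min_def)
    obtain r u where y: "y = (r, u)" by force
    have "y \<in> R1 \<kappa> \<gamma> (rl, ul) \<and> lambda1 \<kappa> \<gamma> y = \<xi> \<longleftrightarrow>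
        0 < r \<and> r < rl \<and> u = v - a * r powr \<theta> \<and> b * r powr \<theta> = v - \<xi>"
      by (auto simp: y R1_def lambda1_def v b_def algebra_simps)
    also have "\<dots> \<longleftrightarrow> r = sonic (v - \<xi>) \<and> u = v - a * r powr \<theta>"
    proof -
      have "0 \<le> b * m powr \<theta>" using b_pos by simp
      then have "max 0 (v - \<xi>) = v - \<xi>" using that by linarith
      then have "b * sonic (v - \<xi>) powr \<theta> = v - \<xi>"
        using b_pos by (simp add: sonic_powr)
      then show ?thesis
        using s \<open>0 \<le> m\<close> sonic_eq[of r "v - \<xi>"]
        by (auto simp del: sonic_pos_iff)
    qed
    finally show ?thesis by (auto simp: y f)
  qed
  show ?thesis
  proof
    assume A: "?L \<and> ?M \<and> ?R"
    then have A1: ?L and A2: ?M and A3: ?R by blast+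
    show "w = fan1 v m rl"
    proof
      fix \<xi>
      consider "\<xi> \<le> v - b * rl powr \<theta>" | "\<xi> \<ge> v - b * m powr \<theta>"
        | "v - b * rl powr \<theta> < \<xi>" "\<xi> < v - b * m powr \<theta>" by linarith
      then show "w \<xi> = fan1 v m rl \<xi>"
      proof cases
        case 1 then show ?thesis using A1 left unfolding l by metis
      next
        case 2 then show ?thesis using A3 right by metis
      next
        case 3 then show ?thesis using A2 mid unfolding l by metis
      qed
    qed
  next
    assume w: "w = fan1 v m rl"
    have ?L unfolding w l using left by blast
    moreover have ?M unfolding w l using mid by blast
    moreover have ?R unfolding w l using right by blast
    ultimately show "?L \<and> ?M \<and> ?R" by blast
  qed
qed

text \<open>The inner states are described by the curve that ends in the right state, which makes
  sense from vacuum as well; \<open>m < fst (w \<xi>)\<close> then takes over the role of the left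
  end.\<close>

lemma fan2_iff:
  assumes "0 \<le> m" "m < rr" and v: "v = ur - a * rr powr \<theta>"
  shows "(\<forall>\<xi>\<le>v + b * m powr \<theta>. w \<xi> = fan_state v a m) \<and>
    (\<forall>\<xi>. v + b * m powr \<theta> < \<xi> \<and> \<xi> < lambda2 \<kappa> \<gamma> (rr, ur) \<longrightarrow>
       m < fst (w \<xi>) \<and> (rr, ur) \<in> R2 \<kappa> \<gamma> (w \<xi>) \<and> lambda2 \<kappa> \<gamma> (w \<xi>) = \<xi>) \<and>
    (\<forall>\<xi>\<ge>lambda2 \<kappa> \<gamma> (rr, ur). w \<xi> = (rr, ur)) \<longleftrightarrow> w = fan2 v m rr"
    (is "?L \<and> ?M \<and> ?R \<longleftrightarrow> _")
proof -
  have l: "lambda2 \<kappa> \<gamma> (rr, ur) = v + b * rr powr \<theta>"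
    by (simp add: lambda2_def v b_def algebra_simps)
  have right: "fan2 v m rr \<xi> = (rr, ur)" if "\<xi> \<ge> v + b * rr powr \<theta>" for \<xi>
  proof -
    have "rr \<le> sonic (\<xi> - v)"
      using that assms by (subst le_sonic_iff) auto
    then show ?thesis
      using assms by (simp add: fan2_def fan_state_def max_def min_def)
  qed
  have left: "fan2 v m rr \<xi> = fan_state v a m" if "\<xi> \<le> v + b * m powr \<theta>" for \<xi>
  proof -
    have "sonic (\<xi> - v) \<le> m"
      using that assms by (subst sonic_le_iff) auto
    then show ?thesis
      using assms by (simp add: fan2_def max_def min_def)
  qed
  have mid: "m < fst y \<and> (rr, ur) \<in> R2 \<kappa> \<gamma> y \<and> lambda2 \<kappa> \<gamma> y = \<xi> \<longleftrightarrow> y = fan2 v m rr \<xi>"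
    if "v + b * m powr \<theta> < \<xi>" "\<xi> < v + b * rr powr \<theta>" for \<xi> y
  proof -
    have s: "m < sonic (\<xi> - v)" "sonic (\<xi> - v) < rr"
      using that assms less_sonic_iff[of m "\<xi> - v"] le_sonic_iff[of rr "\<xi> - v"] by auto
    then have f: "fan2 v m rr \<xi> = (sonic (\<xi> - v), v + a * sonic (\<xi> - v) powr \<theta>)"
      using assms by (simp add: fan2_def fan_state_def max_def min_def)
    obtain r u where y: "y = (r, u)" by force
    have "m < fst y \<and> (rr, ur) \<in> R2 \<kappa> \<gamma> y \<and> lambda2 \<kappa> \<gamma> y = \<xi> \<longleftrightarrow>
        m < r \<and> 0 < r \<and> r < rr \<and> u = v + a * r powr \<theta> \<and> b * r powr \<theta> = \<xi> - v"
      by (auto simp: y R2_def lambda2_def v b_def algebra_simps)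
    also have "\<dots> \<longleftrightarrow> r = sonic (\<xi> - v) \<and> u = v + a * r powr \<theta>"
    proof -
      have "0 \<le> b * m powr \<theta>" using b_pos by simp
      then have "max 0 (\<xi> - v) = \<xi> - v" using that by linarith
      then have "b * sonic (\<xi> - v) powr \<theta> = \<xi> - v"
        using b_pos by (simp add: sonic_powr)
      then show ?thesis
        using s \<open>0 \<le> m\<close> sonic_eq[of r "\<xi> - v"]
        by (auto simp del: sonic_pos_iff)
    qed
    finally show ?thesis by (auto simp: y f)
  qed
  show ?thesis
  proof
    assume A: "?L \<and> ?M \<and> ?R"
    then have A1: ?L and A2: ?M and A3: ?R by blast+
    show "w = fan2 v m rr"
    proof
      fix \<xi>
      consider "\<xi> \<ge> v + b * rr powr \<theta>" | "\<xi> \<le> v + b * m powr \<theta>"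
        | "v + b * rr powr \<theta> > \<xi>" "\<xi> > v + b * m powr \<theta>" by linarith
      then show "w \<xi> = fan2 v m rr \<xi>"
      proof cases
        case 1 then show ?thesis using A3 right unfolding l by metis
      next
        case 2 then show ?thesis using A1 left by metis
      next
        case 3 then show ?thesis using A2 mid unfolding l by metis
      qed
    qed
  next
    assume w: "w = fan2 v m rr"
    have ?L unfolding w l using left by blast
    moreover have ?M unfolding w l using mid by blast
    moreover have ?R unfolding w l using right by blast
    ultimately show "?L \<and> ?M \<and> ?R" by blast
  qed
qed

text \<open>The case \<open>m = rl\<close> falls under the shock formula: both states coincide
  there, so the profile is constant whatever the value of the speed quotient.\<close>

definition profile1 :: "state \<Rightarrow> real \<Rightarrow> real \<Rightarrow> state" where
  "profile1 = (\<lambda>(rl, ul) m.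
     if m < rl then fan1 (ul + a * rl powr \<theta>) m rl
     else (\<lambda>\<xi>. if \<xi> < shock_speed (rl, ul) (m, ul - jump rl m) then (rl, ul)
       else (m, ul - jump rl m)))"

definition profile2 :: "real \<Rightarrow> state \<Rightarrow> real \<Rightarrow> state" where
  "profile2 = (\<lambda>m (rr, ur).
     if m < rr then fan2 (ur - a * rr powr \<theta>) m rr
     else (\<lambda>\<xi>. if \<xi> < shock_speed (m, ur + jump rr m) (rr, ur) then (m, ur + jump rr m)
       else (rr, ur)))"

lemma rarefaction_to_vacuum_iff:
  assumes "0 < rl"
  shows "rarefaction_to_vacuum \<kappa> \<gamma> (rl, ul) w \<longleftrightarrow> w = profile1 (rl, ul) 0"
  using fan1_iff[of 0 rl "ul + a * rl powr \<theta>" ul w] assms theta_pos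
  by (simp add: rarefaction_to_vacuum_def profile1_def vacuum_speed1_def fan_state_def)

lemma rarefaction_from_vacuum_iff:
  assumes "0 < rr"
  shows "rarefaction_from_vacuum \<kappa> \<gamma> (rr, ur) w \<longleftrightarrow> w = profile2 0 (rr, ur)"
proof -
  let ?v = "ur - a * rr powr \<theta>"
  have "(rr, ur) \<in> R2 \<kappa> \<gamma> y \<Longrightarrow> 0 < fst y" for y
    by (auto simp: R2_def)
  then have "(\<forall>\<xi>. ?v < \<xi> \<and> \<xi> < lambda2 \<kappa> \<gamma> (rr, ur) \<longrightarrow>
        0 < fst (w \<xi>) \<and> (rr, ur) \<in> R2 \<kappa> \<gamma> (w \<xi>) \<and> lambda2 \<kappa> \<gamma> (w \<xi>) = \<xi>) \<longleftrightarrow>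
      (\<forall>\<xi>. ?v < \<xi> \<and> \<xi> < lambda2 \<kappa> \<gamma> (rr, ur) \<longrightarrow>
        (rr, ur) \<in> R2 \<kappa> \<gamma> (w \<xi>) \<and> lambda2 \<kappa> \<gamma> (w \<xi>) = \<xi>)"
    by blast
  then show ?thesis
    using fan2_iff[of 0 rr ?v ur w] assms theta_pos
    by (simp add: rarefaction_from_vacuum_def profile2_def vacuum_speed2_def fan_state_def)
qed

lemma wave1_iff:
  assumes "0 < rl"
  shows "wave1 \<kappa> \<gamma> (rl, ul) (m, u) w \<longleftrightarrow> 0 < m \<and> u = ul - jump rl m \<and> w = profile1 (rl, ul) m"
proof (cases "m < rl")
  case True
  let ?v = "ul + a * rl powr \<theta>"
  show ?thesis
  proof (cases "0 < m \<and> u = ul - jump rl m")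
    case mu: True
    then have "lambda1 \<kappa> \<gamma> (m, u) = ?v - b * m powr \<theta>" "fan_state ?v (- a) m = (m, u)"
      using True by (auto simp: lambda1_def jump_def b_def fan_state_def algebra_simps)
    moreover have "(m, u) \<in> R1 \<kappa> \<gamma> (rl, ul)" "(m, u) \<notin> S1 \<kappa> \<gamma> (rl, ul)" "(m, u) \<noteq> (rl, ul)"
      using True mu by (auto simp: mem_R1_iff mem_S1_iff)
    ultimately show ?thesis
      using fan1_iff[of m rl ?v ul w] True mu by (simp add: profile1_def wave1_def)
  next
    case False
    then show ?thesis
      using True by (auto simp: wave1_def mem_R1_iff mem_S1_iff)
  qed
next
  case False
  then show ?thesis
    using assms
    by (cases "m = rl")
      (auto simp: wave1_def mem_R1_iff mem_S1_iff profile1_def shock_profile_def fun_eq_iff)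
qed

lemma wave2_iff:
  assumes "0 < rr"
  shows "wave2 \<kappa> \<gamma> (m, u) (rr, ur) w \<longleftrightarrow> 0 < m \<and> u = ur + jump rr m \<and> w = profile2 m (rr, ur)"
proof (cases "m < rr")
  case True
  let ?v = "ur - a * rr powr \<theta>"
  \<comment> \<open>\<open>wave2\<close> uses the forward curve from the intermediate state,
    \<open>fan2_iff\<close> the one ending in the right state. The bound on the speed forces
    \<open>r < rr\<close>, and then the two descriptions agree.\<close>
  have R2eq: "y \<in> R2 \<kappa> \<gamma> (m, u) \<and> lambda2 \<kappa> \<gamma> y = \<xi> \<longleftrightarrow>
      m < fst y \<and> (rr, ur) \<in> R2 \<kappa> \<gamma> y \<and> lambda2 \<kappa> \<gamma> y = \<xi>"
    if "0 < m" "u = ur + jump rr m" "\<xi> < lambda2 \<kappa> \<gamma> (rr, ur)" for y \<xi>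
  proof -
    obtain r u' where y: "y = (r, u')" by force
    have r: "r < rr" if "0 < r" "u' = ?v + a * r powr \<theta>" "lambda2 \<kappa> \<gamma> y = \<xi>"
    proof -
      have "b * r powr \<theta> < b * rr powr \<theta>"
        using that \<open>\<xi> < _\<close> by (simp add: y lambda2_def b_def algebra_simps)
      then have "r powr \<theta> < rr powr \<theta>" using b_pos by simp
      then show ?thesis
        using powr_theta_le[of rr r] assms by force
    qed
    have "y \<in> R2 \<kappa> \<gamma> (m, u) \<longleftrightarrow> m < r \<and> u' = ?v + a * r powr \<theta>"
      using that True by (auto simp: y R2_def jump_def algebra_simps)
    moreover have "(rr, ur) \<in> R2 \<kappa> \<gamma> y \<longleftrightarrow> 0 < r \<and> r < rr \<and> u' = ?v + a * r powr \<theta>"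
      by (auto simp: y R2_def)
    ultimately show ?thesis
      using r \<open>0 < m\<close> by (auto simp: y)
  qed
  show ?thesis
  proof (cases "0 < m \<and> u = ur + jump rr m")
    case mu: True
    then have "(\<forall>\<xi>. lambda2 \<kappa> \<gamma> (m, u) < \<xi> \<and> \<xi> < lambda2 \<kappa> \<gamma> (rr, ur) \<longrightarrow>
          w \<xi> \<in> R2 \<kappa> \<gamma> (m, u) \<and> lambda2 \<kappa> \<gamma> (w \<xi>) = \<xi>) \<longleftrightarrow>
        (\<forall>\<xi>. lambda2 \<kappa> \<gamma> (m, u) < \<xi> \<and> \<xi> < lambda2 \<kappa> \<gamma> (rr, ur) \<longrightarrow>
          m < fst (w \<xi>) \<and> (rr, ur) \<in> R2 \<kappa> \<gamma> (w \<xi>) \<and> lambda2 \<kappa> \<gamma> (w \<xi>) = \<xi>)"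
      using R2eq by blast
    moreover have "lambda2 \<kappa> \<gamma> (m, u) = ?v + b * m powr \<theta>" "fan_state ?v a m = (m, u)"
      using True mu by (auto simp: lambda2_def jump_def b_def fan_state_def algebra_simps)
    moreover have "(rr, ur) \<in> R2 \<kappa> \<gamma> (m, u)" "(rr, ur) \<notin> S2 \<kappa> \<gamma> (m, u)" "(rr, ur) \<noteq> (m, u)"
      using True mu by (auto simp: mem_R2_iff mem_S2_iff)
    ultimately show ?thesis
      using fan2_iff[of m rr ?v ur w] True mu by (simp add: profile2_def wave2_def)
  next
    case False
    then show ?thesis
      using True by (auto simp: wave2_def mem_R2_iff mem_S2_iff)
  qed
next
  case False
  then show ?thesis
    using assms
    by (cases "m = rr")
      (auto simp: wave2_def mem_R2_iff mem_S2_iff profile2_def shock_profile_def fun_eq_iff)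
qed

subsection \<open>The intermediate density\<close>

context
  fixes rr ur :: real
  assumes rr_pos: "0 < rr"
begin

text \<open>Velocity on the backward 2-curve minus velocity on the forward 1-curve from
  \<open>(s, 0)\<close>, at density \<open>r\<close>. The curves cross at a root, and
  \<open>0 \<le> gap s 0\<close> is the condition for vacuum in the middle.\<close>

definition gap :: "real \<Rightarrow> real \<Rightarrow> real" where
  "gap s r = jump s r + (ur + jump rr r)"

text \<open>Left vacuum is split off because division by zero makes \<open>jump 0 r\<close> equal to
  0 for positive \<open>r\<close>, where the limit as the base tends to 0 is infinite.\<close>

definition mid :: "real \<Rightarrow> real" where
  "mid s = (if s = 0 \<or> 0 \<le> gap s 0 then 0 else (THE r. 0 < r \<and> gap s r = 0))"

lemma gap_strict_mono: "0 < s \<Longrightarrow> 0 \<le> r \<Longrightarrow> r < r' \<Longrightarrow> gap s r < gap s r'"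
  using jump_strict_mono[of s r r'] jump_strict_mono[OF rr_pos, of r r'] by (simp add: gap_def)

lemma gap_root_unique:
  "0 < s \<Longrightarrow> 0 \<le> r \<Longrightarrow> 0 \<le> r' \<Longrightarrow> gap s r = 0 \<Longrightarrow> gap s r' = 0 \<Longrightarrow> r = r'"
  using gap_strict_mono[of s r r'] gap_strict_mono[of s r' r] by linarith

lemma gap_root_exists:
  assumes "0 < s" "gap s 0 < 0"
  shows "\<exists>r>0. gap s r = 0"
proof -
  obtain R where R: "\<And>r. R \<le> r \<Longrightarrow> \<bar>ur\<bar> + 1 < jump rr r"
    using jump_unbounded[OF rr_pos] by blast
  \<comment> \<open>Past \<open>s\<close> the first jump is nonnegative, and past \<open>R\<close>
    the second outweighs \<open>ur\<close>.\<close>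
  define x where "x = max R s"
  have "0 \<le> jump s x"
    using jump_mono[of s s x] assms by (simp add: x_def)
  then have "0 \<le> gap s x"
    using R[of x] by (simp add: gap_def x_def)
  moreover have "continuous_on {0..x} (gap s)"
    unfolding gap_def
    by (intro continuous_intros continuous_on_subset[OF continuous_on_jump] assms rr_pos) auto
  moreover have "0 \<le> x" using assms by (simp add: x_def)
  ultimately obtain r where "0 \<le> r" "gap s r = 0"
    using IVT'[of "gap s" 0 0 x] assms by auto
  then show ?thesis
    using assms(2) by (metis order_le_less order_less_irrefl)
qed

lemma mid_root:
  assumes "0 < s" "gap s 0 < 0"
  shows "0 < mid s" "gap s (mid s) = 0"
proof -
  have "\<exists>!r. 0 < r \<and> gap s r = 0"
    using gap_root_exists[OF assms] gap_root_unique[OF assms(1)] by (metis less_imp_le)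
  then have "0 < mid s \<and> gap s (mid s) = 0"
    unfolding mid_def using theI'[of "\<lambda>r. 0 < r \<and> gap s r = 0"] assms by simp
  then show "0 < mid s" "gap s (mid s) = 0" by auto
qed

lemma mid_eq_0: "s = 0 \<or> 0 \<le> gap s 0 \<Longrightarrow> mid s = 0"
  by (simp add: mid_def)

lemma mid_cases:
  assumes "0 \<le> s"
  obtains "mid s = 0" "s = 0" | "mid s = 0" "0 < s" "0 \<le> gap s 0"
    | "0 < mid s" "0 < s" "gap s (mid s) = 0" "gap s 0 < 0"
  using mid_root[of s] mid_eq_0[of s] assms by (cases "s = 0"; cases "0 \<le> gap s 0") auto

lemma mid_nonneg: "0 \<le> s \<Longrightarrow> 0 \<le> mid s"
  by (erule mid_cases) auto

lemma mid_eqI: "0 < s \<Longrightarrow> 0 < r \<Longrightarrow> gap s r = 0 \<Longrightarrow> mid s = r"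
  using gap_strict_mono[of s 0 r] gap_root_unique[of s r "mid s"] mid_root[of s] by fastforce

text \<open>Together with \<open>mid_less_iff\<close> this turns order conditions on the root into
  strict sign conditions on \<open>gap\<close>, so continuity of \<open>mid\<close> follows from
  that of \<open>gap\<close> in \<open>s\<close>, with no implicit function theorem.\<close>

lemma less_mid_iff:
  assumes "0 \<le> s" "0 \<le> r"
  shows "r < mid s \<longleftrightarrow> 0 < s \<and> gap s r < 0"
  using assms(1)
proof (cases rule: mid_cases)
  case 2
  then show ?thesis
    using assms gap_strict_mono[of s 0 r] by (cases "r = 0") auto
next
  case 3
  then show ?thesis
    using assms gap_strict_mono[of s r "mid s"] gap_strict_mono[of s "mid s" r]
    by (cases r "mid s" rule: linorder_cases) auto
qed (use assms in auto)

lemma mid_less_iff: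
  assumes "0 \<le> s" "0 < r"
  shows "mid s < r \<longleftrightarrow> s = 0 \<or> 0 < gap s r"
  using assms(1)
proof (cases rule: mid_cases)
  case 2
  then show ?thesis
    using assms gap_strict_mono[of s 0 r] by auto
next
  case 3
  then show ?thesis
    using assms gap_strict_mono[of s r "mid s"] gap_strict_mono[of s "mid s" r]
    by (cases r "mid s" rule: linorder_cases) auto
qed (use assms in auto)

lemma gap_strict_antimono: "0 \<le> r \<Longrightarrow> 0 < s \<Longrightarrow> s < s' \<Longrightarrow> gap s' r < gap s r"
  using jump_strict_antimono[of r s s'] by (simp add: gap_def)

text \<open>A larger \<open>s\<close> lowers \<open>gap\<close>, which pushes its root to the right.
  Positivity excludes the range where \<open>mid\<close> rests at vacuum.\<close>

lemma mid_strict_mono: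
  assumes "0 < mid s" "0 \<le> s" "s < s'"
  shows "mid s < mid s'"
  using assms(2)
proof (cases rule: mid_cases)
  case 3
  then have "gap s' (mid s) < 0"
    using assms gap_strict_antimono[of "mid s" s s'] by simp
  then show ?thesis
    using assms by (subst less_mid_iff) auto
qed (use assms in auto)

lemma mid_mono: "0 \<le> s \<Longrightarrow> s \<le> s' \<Longrightarrow> mid s \<le> mid s'"
  using mid_strict_mono[of s s'] mid_nonneg[of s] mid_nonneg[of s'] by (cases "s = s'"; cases "mid s = 0") auto

lemma tendsto_gap_base:
  assumes "0 \<le> r" "0 < s"
  shows "((\<lambda>s. gap s r) \<longlongrightarrow> gap s r) (at s)"
proof -
  have "continuous_on {0<..} (\<lambda>s. gap s r)"
    unfolding gap_def by (intro continuous_intros continuous_on_jump_base assms)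
  then show ?thesis
    using assms by (simp add: continuous_on_eq_continuous_at isCont_def)
qed

lemma continuous_on_mid: "continuous_on {0..} mid"
  unfolding continuous_on_def
proof
  fix s0 :: real assume "s0 \<in> {0..}"
  then have s0: "0 \<le> s0" by simp
  let ?F = "at s0 within {0..}"
  have nonneg: "\<forall>\<^sub>F s in ?F. 0 \<le> s"
    by (simp add: eventually_at_filter)
  have pos: "\<forall>\<^sub>F s in ?F. 0 < s" if "0 < s0"
    using that order_tendstoD(1)[OF tendsto_ident_at] by blast
  show "(mid \<longlongrightarrow> mid s0) ?F"
  proof (rule order_tendstoI)
    fix y assume y: "y < mid s0"
    show "\<forall>\<^sub>F s in ?F. y < mid s"
    proof (cases "y < 0")
      case True
      from nonneg show ?thesis
        by eventually_elim (use True mid_nonneg in fastforce)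
    next
      case False
      then have s: "0 < s0" "gap s0 y < 0"
        using y s0 less_mid_iff[of s0 y] by auto
      have "((\<lambda>s. gap s y) \<longlongrightarrow> gap s0 y) ?F"
        using s False by (intro tendsto_within_subset[OF tendsto_gap_base[of y s0] subset_UNIV]) auto
      then have "\<forall>\<^sub>F s in ?F. gap s y < 0"
        using s by (auto dest: order_tendstoD)
      with pos[OF s(1)] show ?thesis
        by eventually_elim (use False less_mid_iff in auto)
    qed
  next
    fix y assume y: "mid s0 < y"
    then have y0: "0 < y" using mid_nonneg[OF s0] by simp
    have "\<forall>\<^sub>F s in ?F. s = 0 \<or> 0 < gap s y"
    proof (cases "s0 = 0")
      case True
      have "\<forall>\<^sub>F s in at_right 0. - (ur + jump rr y) < jump s y"
        using y0 by (rule eventually_jump_gt)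
      then have "\<forall>\<^sub>F s in at_right 0. s = 0 \<or> 0 < gap s y"
        by eventually_elim (auto simp: gap_def)
      then show ?thesis
        unfolding True eventually_at_filter by eventually_elim auto
    next
      case False
      then have s: "0 < s0" "0 < gap s0 y"
        using y y0 s0 mid_less_iff[of s0 y] by auto
      have "((\<lambda>s. gap s y) \<longlongrightarrow> gap s0 y) ?F"
        using s y0 by (intro tendsto_within_subset[OF tendsto_gap_base[of y s0] subset_UNIV]) auto
      then have "\<forall>\<^sub>F s in ?F. 0 < gap s y"
        using s by (auto dest: order_tendstoD)
      then show ?thesis by eventually_elim auto
    qed
    with nonneg show "\<forall>\<^sub>F s in ?F. mid s < y"
      by eventually_elim (use y0 mid_less_iff in auto)
  qed
qed

text \<open>At vacuum this is the edge speed \<open>ur - a * rr powr \<theta>\<close> of the 2-fan,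
  not 0; this choice keeps it continuous and monotone in \<open>s\<close>.\<close>

definition mid_velocity :: "real \<Rightarrow> real" where
  "mid_velocity s = ur + jump rr (mid s)"

lemma mid_velocity_mono: "0 \<le> s \<Longrightarrow> s \<le> s' \<Longrightarrow> mid_velocity s \<le> mid_velocity s'"
  using mid_mono[of s s'] mid_nonneg[of s] rr_pos by (simp add: mid_velocity_def jump_mono)

text \<open>If the middle state is vacuum for both densities, the value does not change, but the
  vacuum condition at \<open>s'\<close> bounds it below by
  \<open>a * s' powr \<theta>\<close>.\<close>

lemma mid_velocity_pos:
  assumes "0 \<le> s" "s < s'" "0 \<le> mid_velocity s"
  shows "0 < mid_velocity s'"
proof (cases "mid s = mid s'")
  case True
  then have m: "mid s' = 0"
    using mid_strict_mono[of s s'] mid_nonneg[of s] assms by fastforce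
  have "0 \<le> s'" using assms by simp
  then show ?thesis
  proof (cases rule: mid_cases)
    case 2
    moreover have "0 < a * s' powr \<theta>" using a_pos 2 by simp
    ultimately show ?thesis
      using m rr_pos assms by (simp add: mid_velocity_def gap_def)
  qed (use m assms in auto)
next
  case False
  then have "mid s < mid s'" using mid_mono[of s s'] assms by simp
  then have "mid_velocity s < mid_velocity s'"
    using mid_nonneg[OF assms(1)] rr_pos by (simp add: mid_velocity_def jump_strict_mono)
  then show ?thesis using assms by simp
qed

lemma mid_velocity_nonneg_large:
  obtains S where "0 < S" "\<And>s. S \<le> s \<Longrightarrow> 0 \<le> mid_velocity s"
proof -
  \<comment> \<open>At densities from \<open>R\<close> on the 2-curve has positive velocity; a large
    \<open>s\<close> makes \<open>gap\<close> negative at \<open>R\<close>, which pushes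
    \<open>mid s\<close> beyond it.\<close>
  obtain R where R: "\<And>r. R \<le> r \<Longrightarrow> - ur < jump rr r" "rr < R"
    using jump_unbounded[OF rr_pos, of "- ur"] by blast
  obtain S where S: "0 < S" "\<And>s. S \<le> s \<Longrightarrow> jump s R < - (ur + jump rr R)"
    using jump_base_unbounded[of R "- (ur + jump rr R)"] R rr_pos by (metis less_eq_real_def less_trans)
  have "0 \<le> mid_velocity s" if "S \<le> s" for s
  proof -
    have "R < mid s"
      using S that R rr_pos by (subst less_mid_iff) (fastforce simp: gap_def)+
    then show ?thesis
      using R(1)[of "mid s"] by (simp add: mid_velocity_def)
  qed
  with S(1) show ?thesis using that by blast
qed

end

subsection \<open>The flux at the junction\<close>

text \<open>Density and velocity of the state of speed \<open>0\<close> in a 1-rarefaction from \<open>(s, 0)\<close>.\<close>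

definition sonic_density :: "real \<Rightarrow> real" where
  "sonic_density s = sonic (a * s powr \<theta>)"

definition sonic_velocity :: "real \<Rightarrow> real" where
  "sonic_velocity s = a * s powr \<theta> - a * sonic_density s powr \<theta>"

lemma sonic_density_powr: "b * sonic_density s powr \<theta> = a * s powr \<theta>"
  using a_pos b_pos by (simp add: sonic_density_def sonic_powr)

text \<open>At speed 0 the velocity equals the sound speed. As a multiple of
  \<open>s powr \<theta>\<close> it is visibly nonnegative and increasing, unlike the defining
  difference.\<close>

lemma sonic_velocity_eq: "sonic_velocity s = c / b * (a * s powr \<theta>)"
proof -
  have "sonic_velocity s = c * sonic_density s powr \<theta>"
    using sonic_density_powr[of s] by (simp add: sonic_velocity_def b_def algebra_simps)
  also have "\<dots> = c / b * (b * sonic_density s powr \<theta>)"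
    using b_pos by simp
  finally show ?thesis by (simp add: sonic_density_powr)
qed

lemma sonic_density_nonneg [simp]: "0 \<le> sonic_density s"
  by (simp add: sonic_density_def)

lemma sonic_density_zero [simp]: "sonic_density 0 = 0"
  using sonic_eq[of 0 0] theta_pos by (simp add: sonic_density_def)

lemma sonic_density_strict_mono: "0 \<le> s \<Longrightarrow> s < s' \<Longrightarrow> sonic_density s < sonic_density s'"
  using less_sonic_iff[of "sonic_density s" "a * s' powr \<theta>"] powr_theta_less[of s s'] a_pos
  by (simp add: sonic_density_powr sonic_density_def[of s'])

lemma sonic_velocity_nonneg: "0 \<le> sonic_velocity s"
  using a_pos b_pos c_pos by (simp add: sonic_velocity_eq)

lemma sonic_velocity_zero [simp]: "sonic_velocity 0 = 0"
  using theta_pos by (simp add: sonic_velocity_eq)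

lemma sonic_velocity_strict_mono: "0 \<le> s \<Longrightarrow> s < s' \<Longrightarrow> sonic_velocity s < sonic_velocity s'"
  unfolding sonic_velocity_eq
  using a_pos b_pos c_pos powr_theta_less[of s s'] by (intro mult_strict_left_mono) auto

lemma continuous_on_sonic_density: "continuous_on {0..} sonic_density"
  unfolding sonic_density_def by (intro continuous_intros) auto

lemma continuous_on_sonic_velocity: "continuous_on {0..} sonic_velocity"
  unfolding sonic_velocity_eq by (intro continuous_intros) auto

context
  fixes rr ur :: real
  assumes rr_pos: "0 < rr"
begin

definition curve_flux :: "real \<Rightarrow> real" where
  "curve_flux r = r * (ur + jump rr r)"

text \<open>Godunov flux at the junction for intermediate density \<open>m\<close> when the 1-wave leaves the
  half-line \<open>x > 0\<close>; \<open>flux_in\<close> below is its counterpart when the 2-wave stays inside.\<close>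

definition flux_out :: "real \<Rightarrow> real" where
  "flux_out m = (if m \<le> rr
     then curve_flux (max m (min rr (sonic (a * rr powr \<theta> - ur))))
     else max (curve_flux m) (curve_flux rr))"

definition flux_in :: "real \<Rightarrow> real" where
  "flux_in s = max (mid rr ur s) (sonic_density s) *
     min (max 0 (mid_velocity rr ur s)) (sonic_velocity s)"

text \<open>At most one summand is nonzero: \<open>flux_in\<close> vanishes for
  \<open>mid_velocity \<le> 0\<close>, and \<open>flux_out\<close> is nonnegative for
  \<open>mid_velocity \<ge> 0\<close>. Adding them gives continuity without a case split.\<close>

definition edge_flux :: "real \<Rightarrow> real" where
  "edge_flux s = flux_in s + min 0 (flux_out (mid rr ur s))"

lemma curve_flux_rarefaction:
  "r \<le> rr \<Longrightarrow> curve_flux r = r * (ur - a * rr powr \<theta> + a * r powr \<theta>)"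
  by (simp add: curve_flux_def jump_def algebra_simps)

text \<open>On the rarefaction branch a nonnegative velocity puts the sonic density at or below
  \<open>m\<close>, so the fan does not cross speed 0 and the flux is that of the intermediate
  state.\<close>

lemma flux_out_nonneg:
  assumes "0 \<le> m" "0 \<le> ur + jump rr m"
  shows "0 \<le> flux_out m"
proof (cases "m \<le> rr")
  case True
  have "a * m powr \<theta> \<le> b * m powr \<theta>"
    using c_pos by (intro mult_right_mono) (auto simp: b_def)
  then have "sonic (a * rr powr \<theta> - ur) \<le> m"
    using assms True by (subst sonic_le_iff) (auto simp: jump_def algebra_simps)
  then have "flux_out m = curve_flux m"
    using True by (simp add: flux_out_def)
  then show ?thesis using assms by (simp add: curve_flux_def)
next
  case False
  then show ?thesis
    using assms by (simp add: flux_out_def curve_flux_def le_max_iff_disj)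
qed

lemma flux_out_neg:
  assumes "0 \<le> m" "ur + jump rr m < 0"
  shows "flux_out m < 0"
proof (cases "m \<le> rr")
  case True
  let ?q = "sonic (a * rr powr \<theta> - ur)"
  let ?D = "max m (min rr ?q)"
  have neg: "ur - a * rr powr \<theta> + a * m powr \<theta> < 0"
    using assms True by (simp add: jump_def algebra_simps)
  moreover have am: "0 \<le> a * m powr \<theta>" using a_pos by simp
  ultimately have v: "0 < a * rr powr \<theta> - ur" by linarith
  then have "0 < ?q" by simp
  then have D: "0 < ?D" "?D \<le> rr" using True rr_pos by (auto simp: less_max_iff_disj)
  \<comment> \<open>The edge velocity \<open>ur - a * rr powr \<theta>\<close> is negative. At the
    sonic density the velocity is \<open>c / b\<close> times it, still negative, and at smaller
    densities of the fan it is lower.\<close>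
  have "ur - a * rr powr \<theta> + a * ?D powr \<theta> < 0"
  proof (cases "?D = m")
    case True
    then show ?thesis using neg by simp
  next
    case False
    then have "?D powr \<theta> \<le> ?q powr \<theta>"
      using assms by (intro powr_theta_le) auto
    also have "\<dots> = (a * rr powr \<theta> - ur) / b"
      using v by (simp add: sonic_powr)
    finally have "a * ?D powr \<theta> \<le> a * ((a * rr powr \<theta> - ur) / b)"
      using a_pos by (intro mult_left_mono) auto
    also have "\<dots> < a * rr powr \<theta> - ur"
    proof -
      have "a * (a * rr powr \<theta> - ur) < b * (a * rr powr \<theta> - ur)"
        using v c_pos by (intro mult_strict_right_mono) (auto simp: b_def)
      then show ?thesis
        using b_pos by (simp add: field_simps)
    qed
    finally show ?thesis by simp
  qed
  then have "?D * (ur - a * rr powr \<theta> + a * ?D powr \<theta>) < 0"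
    using D(1) by (rule mult_pos_neg[rotated])
  moreover have "flux_out m = ?D * (ur - a * rr powr \<theta> + a * ?D powr \<theta>)"
    using True curve_flux_rarefaction[OF D(2)] by (simp only: flux_out_def if_True)
  ultimately show ?thesis by simp
next
  case False
  then have "curve_flux m < 0"
    using assms rr_pos by (simp add: curve_flux_def mult_pos_neg)
  moreover have "ur < 0"
    using jump_pos[of rr m] False rr_pos assms by simp
  then have "curve_flux rr < 0"
    using rr_pos by (simp add: curve_flux_def mult_pos_neg)
  ultimately show ?thesis using False by (simp add: flux_out_def)
qed

lemma edge_flux_nonneg:
  assumes "0 \<le> s" "0 \<le> mid_velocity rr ur s"
  shows "edge_flux s = flux_in s" "0 \<le> flux_in s"
  using flux_out_nonneg[of "mid rr ur s"] mid_nonneg[OF rr_pos assms(1), of ur] assms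
    sonic_velocity_nonneg[of s]
  by (auto simp: edge_flux_def flux_in_def mid_velocity_def[OF rr_pos])

lemma edge_flux_neg:
  assumes "0 \<le> s" "mid_velocity rr ur s < 0"
  shows "edge_flux s = flux_out (mid rr ur s)" "flux_out (mid rr ur s) < 0"
  using flux_out_neg[of "mid rr ur s"] mid_nonneg[OF rr_pos assms(1), of ur] assms
    sonic_velocity_nonneg[of s]
  by (auto simp: edge_flux_def flux_in_def mid_velocity_def[OF rr_pos])

text \<open>The derivative of the flux along the rarefaction curve is the second characteristic
  speed, nonnegative from the sonic density on.\<close>

lemma curve_flux_mono:
  assumes "sonic (a * rr powr \<theta> - ur) \<le> r" "r \<le> r'" "r' \<le> rr"
  shows "curve_flux r \<le> curve_flux r'"
proof -
  let ?v = "ur - a * rr powr \<theta>"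
  have "0 \<le> r" using assms(1) sonic_nonneg order_trans by blast
  have "r * (?v + a * r powr \<theta>) \<le> r' * (?v + a * r' powr \<theta>)"
  \<comment> \<open>With \<open>?v\<close> nonnegative, \<open>r = 0\<close> is possible and
    differentiation may fail there, but both factors are nonnegative and increasing. With
    \<open>?v\<close> negative, the sonic density keeps \<open>r\<close> positive.\<close>
  proof (cases "0 \<le> ?v")
    case True
    then show ?thesis
      using assms \<open>0 \<le> r\<close> a_pos powr_theta_le[of r r'] by (intro mult_mono) auto
  next
    case False
    have r: "0 < r"
    proof -
      have "0 < sonic (a * rr powr \<theta> - ur)" using False by simp
      then show ?thesis using assms(1) by linarith
    qed
    show ?thesis
    proof (rule DERIV_nonneg_imp_nondecreasing[OF assms(2)])
      fix x assume x: "r \<le> x" "x \<le> r'"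
      with r have "0 < x" by simp
      then have d: "((\<lambda>r. r * (?v + a * r powr \<theta>)) has_real_derivative
          (?v + a * x powr \<theta>) + x * (a * (\<theta> * x powr (\<theta> - 1)))) (at x)"
        by (auto intro!: derivative_eq_intros)
      have "x * (a * (\<theta> * x powr (\<theta> - 1))) = c * x powr \<theta>"
        using \<open>0 < x\<close> powr_mult_base[of x "\<theta> - 1"] a_theta by (metis (no_types, opaque_lifting)
            add.commute diff_add_cancel less_imp_le mult.assoc mult.commute)
      moreover have "a * rr powr \<theta> - ur \<le> b * x powr \<theta>"
        using assms(1) x \<open>0 < x\<close> by (subst sonic_le_iff[symmetric]) auto
      ultimately have "0 \<le> (?v + a * x powr \<theta>) + x * (a * (\<theta> * x powr (\<theta> - 1)))"
        by (simp add: b_def algebra_simps)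
      with d show "\<exists>y. ((\<lambda>r. r * (?v + a * r powr \<theta>)) has_real_derivative y) (at x) \<and> 0 \<le> y"
        by blast
    qed
  qed
  then show ?thesis
    using assms by (simp add: curve_flux_rarefaction)
qed

text \<open>The shock speed on the backward 2-shock curve increases with the left density.\<close>

lemma shock_chord_mono:
  assumes "rr < m" "m < m'"
  shows "(curve_flux m - curve_flux rr) / (m - rr) \<le> (curve_flux m' - curve_flux rr) / (m' - rr)"
proof -
  \<comment> \<open>Moving \<open>m / (m - rr)\<close> under the root of the jump leaves
    \<open>m\<close> times a chord slope of \<open>powr \<gamma>\<close>, which increases by
    convexity.\<close>
  let ?s = "\<lambda>m. sqrt (\<kappa> / rr * (m * ((rr powr \<gamma> - m powr \<gamma>) / (rr - m))))"
  have eq: "(curve_flux m - curve_flux rr) / (m - rr) = ur + ?s m" if "rr < m" for m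
  proof -
    have "m * jump rr m / (m - rr) = sqrt ((m / (m - rr))\<^sup>2) * jump rr m"
      using that rr_pos by simp
    also have "\<dots>
        = sqrt ((m / (m - rr))\<^sup>2 * (\<kappa> * (m powr \<gamma> - rr powr \<gamma>) * (m - rr) / (m * rr)))"
      unfolding jump_def using that by (subst real_sqrt_mult) simp
    also have "(m / (m - rr))\<^sup>2 * (\<kappa> * (m powr \<gamma> - rr powr \<gamma>) * (m - rr) / (m * rr))
        = \<kappa> / rr * (m * ((m powr \<gamma> - rr powr \<gamma>) / (m - rr)))"
      using that rr_pos by (simp add: power2_eq_square divide_simps)
    also have "(m powr \<gamma> - rr powr \<gamma>) / (m - rr) = (rr powr \<gamma> - m powr \<gamma>) / (rr - m)"
      by (metis minus_diff_eq minus_divide_divide)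
    finally have "m * jump rr m / (m - rr) = ?s m" .
    moreover have "(curve_flux m - curve_flux rr) / (m - rr) = ur + m * jump rr m / (m - rr)"
      using that by (simp add: curve_flux_def field_simps)
    ultimately show ?thesis by simp
  qed
  have "(rr powr \<gamma> - m powr \<gamma>) / (rr - m) \<le> (rr powr \<gamma> - m' powr \<gamma>) / (rr - m')"
    using convex_on_slope_le(1)[OF powr_convex[of \<gamma>], of rr m' m] assms rr_pos gamma_gt_1 by simp
  moreover have "0 \<le> (rr powr \<gamma> - m powr \<gamma>) / (rr - m)"
    using powr_gamma_le[of rr m] assms rr_pos by (simp add: divide_nonpos_neg)
  ultimately have "?s m \<le> ?s m'"
    using assms rr_pos kappa_pos by (intro real_sqrt_le_mono mult_left_mono mult_mono) auto
  then show ?thesis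
    using assms by (simp add: eq)
qed

lemma flux_out_mono:
  assumes "0 \<le> m" "m \<le> m'"
  shows "flux_out m \<le> flux_out m'"
proof -
  let ?q = "min rr (sonic (a * rr powr \<theta> - ur))"
  have rar: "curve_flux (max x ?q) \<le> curve_flux (max x' ?q)" if "x \<le> x'" "x' \<le> rr" for x x'
  proof (cases "sonic (a * rr powr \<theta> - ur) \<le> rr")
    case True
    then show ?thesis
      using that by (intro curve_flux_mono) auto
  qed (use that in \<open>auto simp: max_def min_def\<close>)
  consider "m' \<le> rr" | "m \<le> rr" "rr < m'" | "rr < m" "m < m'" | "m = m'"
    using assms by linarith
  then show ?thesis
  proof cases
    case 1
    then show ?thesis using rar[of m m'] assms by (simp add: flux_out_def)
  next
    case 2
    then show ?thesis using rar[of m rr] by (simp add: flux_out_def le_max_iff_disj max_absorb1)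
  next
    case 3
    \<comment> \<open>The quotient is the shock speed; both \<open>x - rr\<close> and its positive
      part are nonnegative and nondecreasing.\<close>
    have eq: "flux_out x = curve_flux rr + (x - rr) * max 0 ((curve_flux x - curve_flux rr) / (x - rr))"
      if "rr < x" for x
      using that by (auto simp: flux_out_def max_def field_simps)
    have "(m - rr) * max 0 ((curve_flux m - curve_flux rr) / (m - rr))
        \<le> (m' - rr) * max 0 ((curve_flux m' - curve_flux rr) / (m' - rr))"
      using 3 shock_chord_mono[OF 3] by (intro mult_mono max.mono) auto
    then show ?thesis using 3 by (simp add: eq)
  qed simp
qed

lemma continuous_on_curve_flux: "continuous_on {0..} curve_flux"
  unfolding curve_flux_def by (intro continuous_intros continuous_on_jump rr_pos)

lemma continuous_on_flux_out: "continuous_on {0..} flux_out"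
proof -
  let ?q = "min rr (sonic (a * rr powr \<theta> - ur))"
  have "continuous_on {0..} (\<lambda>m. max (curve_flux (max m rr)) (curve_flux rr)
      + curve_flux (max (min m rr) ?q) - curve_flux rr)"
    using rr_pos
    by (intro continuous_intros continuous_on_compose2[OF continuous_on_curve_flux])
      (auto simp: le_max_iff_disj)
  then show ?thesis
    by (rule continuous_on_eq) (auto simp: flux_out_def max_def min_def)
qed

lemma continuous_on_edge_flux: "continuous_on {0..} edge_flux"
proof -
  have m: "continuous_on {0..} (mid rr ur)"
    by (rule continuous_on_mid[OF rr_pos])
  have im: "mid rr ur ` {0..} \<subseteq> {0..}"
    using mid_nonneg[OF rr_pos] by auto
  have u: "continuous_on {0..} (mid_velocity rr ur)"
    unfolding mid_velocity_def[OF rr_pos]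
    by (intro continuous_intros continuous_on_compose2[OF continuous_on_jump[OF rr_pos] m im])
  show ?thesis
    unfolding edge_flux_def flux_in_def
    by (intro continuous_intros continuous_on_compose2[OF continuous_on_flux_out m im] m u
        continuous_on_sonic_density continuous_on_sonic_velocity)
qed

text \<open>Strictness comes from the density factor: even where \<open>mid\<close> rests at 0, the
  sonic density grows. It carries over to the product because the velocity factor at
  \<open>s'\<close> is positive.\<close>

lemma flux_in_strict_mono:
  assumes "0 \<le> s" "s < s'" "0 \<le> mid_velocity rr ur s"
  shows "flux_in s < flux_in s'"
proof -
  let ?D = "\<lambda>s. max (mid rr ur s) (sonic_density s)"
  let ?V = "\<lambda>s. min (max 0 (mid_velocity rr ur s)) (sonic_velocity s)"
  have D: "?D s < ?D s'"
    using sonic_density_strict_mono[of s s'] mid_strict_mono[OF rr_pos, of ur s s']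
      mid_nonneg[OF rr_pos, of s ur] mid_nonneg[OF rr_pos, of s' ur] assms
      sonic_density_nonneg[of s]
    by (cases "mid rr ur s = 0") (auto simp: max_def)
  have V: "?V s \<le> ?V s'" "0 < ?V s'" "0 \<le> ?V s"
    using sonic_velocity_strict_mono[of s s'] mid_velocity_mono[OF rr_pos, of s s' ur]
      mid_velocity_pos[OF rr_pos, of s s' ur] sonic_velocity_nonneg[of s] assms
    by auto
  have "?D s * ?V s \<le> ?D s * ?V s'"
    using V by (intro mult_left_mono) (auto simp: le_max_iff_disj)
  also have "\<dots> < ?D s' * ?V s'"
    using D V by (intro mult_strict_right_mono)
  finally show ?thesis by (simp add: flux_in_def)
qed

lemma edge_flux_strict_mono:
  assumes "0 \<le> s" "s < s'" "0 \<le> edge_flux s"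
  shows "edge_flux s < edge_flux s'"
proof -
  have u: "0 \<le> mid_velocity rr ur s"
    using edge_flux_neg[of s] assms by force
  then have "0 \<le> mid_velocity rr ur s'"
    using mid_velocity_mono[OF rr_pos, of s s' ur] assms by simp
  then show ?thesis
    using flux_in_strict_mono[OF assms(1,2) u] edge_flux_nonneg[of s] edge_flux_nonneg[of s'] assms u
    by simp
qed

lemma edge_flux_mono:
  assumes "0 \<le> s" "s \<le> s'"
  shows "edge_flux s \<le> edge_flux s'"
proof (cases "s = s' \<or> 0 \<le> edge_flux s")
  case True
  then show ?thesis using edge_flux_strict_mono[of s s'] assms by force
next
  case False
  then have u: "mid_velocity rr ur s < 0"
    using edge_flux_nonneg[of s] assms by force
  show ?thesis
  proof (cases "0 \<le> mid_velocity rr ur s'")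
    case True
    then show ?thesis using edge_flux_nonneg[of s'] False assms by simp
  next
    case False
    then show ?thesis
      using edge_flux_neg[of s] edge_flux_neg[of s'] u assms mid_nonneg[OF rr_pos, of s ur]
        flux_out_mono[of "mid rr ur s" "mid rr ur s'"] mid_mono[OF rr_pos, of s s' ur]
      by simp
  qed
qed

lemma edge_flux_0: "edge_flux 0 \<le> 0"
  by (simp add: edge_flux_def flux_in_def mid_def[OF rr_pos])

lemma edge_flux_nonneg_large: "\<exists>S. \<forall>s\<ge>S. 0 \<le> edge_flux s"
proof -
  obtain S where S: "0 < S" "\<And>s. S \<le> s \<Longrightarrow> 0 \<le> mid_velocity rr ur s"
    using mid_velocity_nonneg_large[OF rr_pos, of ur] by blast
  have "0 \<le> edge_flux s" if "S \<le> s" for s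
    using edge_flux_nonneg[of s] S that by simp
  then show ?thesis by blast
qed

end

subsection \<open>Traces of Lax solutions\<close>

text \<open>The right edge of a rarefaction moves at \<open>u - c * m powr \<theta>\<close>, where
  \<open>u\<close> is the intermediate velocity; a shock is slower than \<open>u\<close> because it
  decelerates the gas. Needed both to join the profiles and to keep the 1-wave off the half-line
  when \<open>u < 0\<close>.\<close>

lemma profile1_ge:
  assumes "0 < rl" "0 < m"
  obtains e where "e < ul - jump rl m" "\<And>\<xi>. e \<le> \<xi> \<Longrightarrow> profile1 (rl, ul) m \<xi> = (m, ul - jump rl m)"
proof -
  consider "m < rl" | "m = rl" | "rl < m" by linarith
  then show ?thesis
  proof cases
    case 1
    let ?v = "ul + a * rl powr \<theta>"
    have "ul - jump rl m = ?v - b * m powr \<theta> + c * m powr \<theta>"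
      using 1 by (simp add: jump_def b_def algebra_simps)
    moreover have "0 < c * m powr \<theta>" using assms c_pos by (intro mult_pos_pos) auto
    moreover have "fan_state ?v (- a) m = (m, ul - jump rl m)"
      using 1 assms by (simp add: fan_state_def jump_def algebra_simps)
    moreover have "\<forall>\<xi>\<ge>?v - b * m powr \<theta>. fan1 ?v m rl \<xi> = fan_state ?v (- a) m"
      using fan1_iff[of m rl ?v ul "fan1 ?v m rl"] 1 less_imp_le[OF assms(2)] by blast
    ultimately show ?thesis
      using 1 by (intro that[of "?v - b * m powr \<theta>"]) (simp_all add: profile1_def)
  next
    case 2
    then show ?thesis by (intro that[of "ul - 1"]) (auto simp: profile1_def)
  next
    case 3
    have "ul - jump rl m < ul" using jump_pos[of rl m] 3 assms by simp
    then have "rl * (ul - jump rl m) < rl * ul"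
      using assms by simp
    then have "m * (ul - jump rl m) - rl * ul < (ul - jump rl m) * (m - rl)"
      by (simp add: algebra_simps)
    moreover have "0 < m - rl" using 3 by simp
    ultimately have "shock_speed (rl, ul) (m, ul - jump rl m) < ul - jump rl m"
      by (simp only: shock_speed_def prod.case pos_divide_less_eq)
    with 3 show ?thesis
      by (intro that[of "shock_speed (rl, ul) (m, ul - jump rl m)"]) (auto simp: profile1_def)
  qed
qed

text \<open>Mirror image of \<open>profile1_ge\<close>. The range is open at \<open>e\<close>
  because a shock profile takes its right state on the shock line.\<close>

lemma profile2_less:
  assumes "0 < rr" "0 < m"
  obtains e where "ur + jump rr m < e" "\<And>\<xi>. \<xi> < e \<Longrightarrow> profile2 m (rr, ur) \<xi> = (m, ur + jump rr m)"
proof -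
  consider "m < rr" | "m = rr" | "rr < m" by linarith
  then show ?thesis
  proof cases
    case 1
    let ?v = "ur - a * rr powr \<theta>"
    have "ur + jump rr m = ?v + b * m powr \<theta> - c * m powr \<theta>"
      using 1 by (simp add: jump_def b_def algebra_simps)
    moreover have "0 < c * m powr \<theta>" using assms c_pos by (intro mult_pos_pos) auto
    moreover have "fan_state ?v a m = (m, ur + jump rr m)"
      using 1 assms by (simp add: fan_state_def jump_def algebra_simps)
    moreover have "\<forall>\<xi>\<le>?v + b * m powr \<theta>. fan2 ?v m rr \<xi> = fan_state ?v a m"
      using fan2_iff[of m rr ?v ur "fan2 ?v m rr"] 1 less_imp_le[OF assms(2)] by blast
    ultimately show ?thesis
      using 1 by (intro that[of "?v + b * m powr \<theta>"]) (auto simp: profile2_def)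
  next
    case 2
    then show ?thesis by (intro that[of "ur + 1"]) (auto simp: profile2_def)
  next
    case 3
    have "ur < ur + jump rr m" using jump_pos[of rr m] 3 assms by simp
    then have "rr * ur < rr * (ur + jump rr m)"
      using assms by simp
    then have "rr * ur - m * (ur + jump rr m) < (ur + jump rr m) * (rr - m)"
      by (simp add: algebra_simps)
    moreover have "rr - m < 0" using 3 by simp
    ultimately have "ur + jump rr m < shock_speed (m, ur + jump rr m) (rr, ur)"
      by (simp only: shock_speed_def prod.case neg_less_divide_eq)
    with 3 show ?thesis
      by (intro that[of "shock_speed (m, ur + jump rr m) (rr, ur)"]) (auto simp: profile2_def)
  qed
qed

lemma profile1_vacuum:
  "0 < rl \<Longrightarrow> ul + a * rl powr \<theta> \<le> \<xi> \<Longrightarrow> profile1 (rl, ul) 0 \<xi> = vacuum"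
  using fan1_iff[of 0 rl "ul + a * rl powr \<theta>" ul "fan1 (ul + a * rl powr \<theta>) 0 rl"] theta_pos
  by (simp add: profile1_def fan_state_def)

lemma profile2_vacuum:
  "0 < rr \<Longrightarrow> \<xi> \<le> ur - a * rr powr \<theta> \<Longrightarrow> profile2 0 (rr, ur) \<xi> = vacuum"
  using fan2_iff[of 0 rr "ur - a * rr powr \<theta>" ur "fan2 (ur - a * rr powr \<theta>) 0 rr"] theta_pos
  by (simp add: profile2_def fan_state_def)

lemma profile2_right_state:
  assumes "0 < rr" "0 \<le> m"
  obtains e where "\<And>\<xi>. e \<le> \<xi> \<Longrightarrow> profile2 m (rr, ur) \<xi> = (rr, ur)"
proof (cases "m < rr")
  case True
  let ?v = "ur - a * rr powr \<theta>"
  have "\<forall>\<xi>\<ge>lambda2 \<kappa> \<gamma> (rr, ur). fan2 ?v m rr \<xi> = (rr, ur)"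
    using fan2_iff[of m rr ?v ur "fan2 ?v m rr"] True assms by blast
  then show ?thesis
    using True by (intro that[of "lambda2 \<kappa> \<gamma> (rr, ur)"]) (auto simp: profile2_def)
next
  case False
  then show ?thesis
    by (intro that[of "shock_speed (m, ur + jump rr m) (rr, ur)"]) (auto simp: profile2_def)
qed

lemma fan_state_gas: "0 \<le> r \<Longrightarrow> fan_state v k r \<in> gas_states"
  by (auto simp: fan_state_def gas_states_def)

lemma profile1_gas: "0 < rl \<Longrightarrow> 0 \<le> m \<Longrightarrow> profile1 (rl, ul) m \<xi> \<in> gas_states"
  using fan_state_gas[of "max m (min rl (sonic (ul + a * rl powr \<theta> - \<xi>)))"]
  by (auto simp: profile1_def fan1_def gas_states_def le_max_iff_disj)

lemma profile2_gas: "0 < rr \<Longrightarrow> 0 \<le> m \<Longrightarrow> profile2 m (rr, ur) \<xi> \<in> gas_states"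
  using fan_state_gas[of "max m (min rr (sonic (\<xi> - (ur - a * rr powr \<theta>))))"]
  by (auto simp: profile2_def fan2_def gas_states_def le_max_iff_disj)

definition has_edge_flux :: "(real \<Rightarrow> state) \<Rightarrow> real \<Rightarrow> bool" where
  "has_edge_flux w q \<longleftrightarrow> (\<exists>V. (w \<longlongrightarrow> V) (at_right 0) \<and> fst V * snd V = q)"

lemma has_edge_flux_const:
  assumes "0 < e" "\<And>\<xi>. 0 < \<xi> \<Longrightarrow> \<xi> < e \<Longrightarrow> w \<xi> = V" "fst V * snd V = q"
  shows "has_edge_flux w q"
proof -
  have "\<forall>\<^sub>F \<xi> in at_right 0. w \<xi> = V"
    using eventually_at_right_real[OF assms(1)] by eventually_elim (use assms in auto)
  then show ?thesis
    unfolding has_edge_flux_def using assms(3) by (intro exI[of _ V]) (auto intro: tendsto_eventually)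
qed

lemma has_edge_flux_cong:
  assumes "has_edge_flux w' q" "\<And>\<xi>. 0 < \<xi> \<Longrightarrow> \<xi> < e \<Longrightarrow> w \<xi> = w' \<xi>" "0 < e"
  shows "has_edge_flux w q"
proof -
  have "\<forall>\<^sub>F \<xi> in at_right 0. w \<xi> = w' \<xi>"
    using eventually_at_right_real[OF assms(3)] by eventually_elim (use assms in auto)
  then show ?thesis
    using assms(1) tendsto_cong unfolding has_edge_flux_def by blast
qed

text \<open>\<open>fan_state\<close> may jump at density 0, so the limit is taken of the
  unconditional velocity formula. Positivity of \<open>D\<close> is asked only for positive speeds,
  which admits \<open>D 0 = 0\<close>.\<close>

lemma has_edge_flux_fan:
  assumes "0 < e" "\<And>\<xi>. 0 < \<xi> \<Longrightarrow> \<xi> < e \<Longrightarrow> 0 < D \<xi> \<and> w \<xi> = fan_state v k (D \<xi>)"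
    and D: "continuous_on UNIV D" "\<And>\<xi>. 0 \<le> D \<xi>"
  shows "has_edge_flux w (D 0 * (v + k * D 0 powr \<theta>))"
proof -
  have "continuous_on UNIV (\<lambda>\<xi>. (D \<xi>, v + k * D \<xi> powr \<theta>))"
    using D by (intro continuous_intros) auto
  then have "((\<lambda>\<xi>. (D \<xi>, v + k * D \<xi> powr \<theta>)) \<longlongrightarrow> (D 0, v + k * D 0 powr \<theta>)) (at 0)"
    unfolding continuous_on_def by (rule bspec) simp
  then have "((\<lambda>\<xi>. (D \<xi>, v + k * D \<xi> powr \<theta>)) \<longlongrightarrow> (D 0, v + k * D 0 powr \<theta>)) (at_right 0)"
    by (rule tendsto_within_subset) simp
  then have "has_edge_flux (\<lambda>\<xi>. (D \<xi>, v + k * D \<xi> powr \<theta>)) (D 0 * (v + k * D 0 powr \<theta>))"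
    unfolding has_edge_flux_def by (intro exI conjI) auto
  moreover have "w \<xi> = (D \<xi>, v + k * D \<xi> powr \<theta>)" if "0 < \<xi>" "\<xi> < e" for \<xi>
    using assms(2)[OF that] by (simp add: fan_state_def)
  ultimately show ?thesis
    using assms(1) by (rule has_edge_flux_cong)
qed

lemma profile1_edge_flux:
  assumes "0 < s" "0 \<le> m" "m \<le> s"
  shows "has_edge_flux (profile1 (s, 0) m)
    (max m (sonic_density s) * min (a * s powr \<theta> - a * m powr \<theta>) (sonic_velocity s))"
proof (cases "m = s")
  case True
  then have "profile1 (s, 0) m \<xi> = (s, 0)" for \<xi>
    by (simp add: profile1_def)
  then show ?thesis
    using True sonic_velocity_nonneg[of s] by (intro has_edge_flux_const[of 1]) auto
next
  case False
  let ?D = "\<lambda>\<xi>. max m (min s (sonic (a * s powr \<theta> - \<xi>)))"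
  have pos: "0 < a * s powr \<theta>" using assms a_pos by simp
  have D: "0 < ?D \<xi>" if "\<xi> < a * s powr \<theta>" for \<xi>
    using that assms by (auto simp: less_max_iff_disj)
  have "has_edge_flux (profile1 (s, 0) m) (?D 0 * (a * s powr \<theta> + (- a) * ?D 0 powr \<theta>))"
    using pos
  proof (rule has_edge_flux_fan)
    show "0 < ?D \<xi> \<and> profile1 (s, 0) m \<xi> = fan_state (a * s powr \<theta>) (- a) (?D \<xi>)"
      if "\<xi> < a * s powr \<theta>" for \<xi>
      using D[OF that] False assms by (simp add: profile1_def fan1_def)
    show "continuous_on UNIV ?D" by (intro continuous_intros)
  qed (use assms in \<open>auto simp: le_max_iff_disj\<close>)
  \<comment> \<open>The left state is at rest, hence its 1-speed is negative and the upper clamp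
    \<open>s\<close> is inactive at speed 0.\<close>
  moreover have "sonic_density s \<le> s"
  proof -
    have "a * s powr \<theta> \<le> b * s powr \<theta>"
      using c_pos by (intro mult_right_mono) (auto simp: b_def)
    then show ?thesis
      using assms by (simp add: sonic_density_def sonic_le_iff)
  qed
  then have "?D 0 = max m (sonic_density s)"
    by (simp add: sonic_density_def)
  moreover have "a * s powr \<theta> + (- a) * max m (sonic_density s) powr \<theta>
      = min (a * s powr \<theta> - a * m powr \<theta>) (sonic_velocity s)"
  proof (cases "m \<le> sonic_density s")
    case True
    then have "a * m powr \<theta> \<le> a * sonic_density s powr \<theta>"
      using powr_theta_le assms a_pos by (intro mult_left_mono) auto
    then show ?thesis using True by (simp add: sonic_velocity_def)
  next
    case False
    then have "a * sonic_density s powr \<theta> \<le> a * m powr \<theta>"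
      using powr_theta_le assms a_pos by (intro mult_left_mono) auto
    then show ?thesis using False by (simp add: sonic_velocity_def)
  qed
  ultimately show ?thesis by simp
qed

text \<open>A shock shows at \<open>0+\<close> its left state if its speed is positive and its right
  state otherwise. The sign of the speed is the sign of the flux difference, so the visible flux is
  the larger one; at speed 0 both agree.\<close>

lemma profile2_edge_flux:
  assumes "0 < rr" "0 \<le> m"
  shows "has_edge_flux (profile2 m (rr, ur)) (flux_out rr ur m)"
proof (cases "m < rr")
  case True
  let ?v = "ur - a * rr powr \<theta>"
  let ?D = "\<lambda>\<xi>. max m (min rr (sonic (\<xi> - ?v)))"
  have fl: "flux_out rr ur m = curve_flux rr ur (?D 0)"
    using True by (simp add: flux_out_def[OF assms(1)])
  show ?thesis
  proof (cases "m = 0 \<and> 0 < ?v")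
    case vac: True
    then have "sonic (0 - ?v) = 0"
      by (intro sonic_eq_0) simp
    then have "flux_out rr ur m = 0"
      using fl vac assms by (simp add: curve_flux_def[OF assms(1)])
    then show ?thesis
      using vac profile2_vacuum[of rr _ ur] assms by (intro has_edge_flux_const[of ?v]) auto
  next
    case False
    have "has_edge_flux (profile2 m (rr, ur)) (?D 0 * (?v + a * ?D 0 powr \<theta>))"
      using zero_less_one
    proof (rule has_edge_flux_fan)
      show "0 < ?D \<xi> \<and> profile2 m (rr, ur) \<xi> = fan_state ?v a (?D \<xi>)" if "0 < \<xi>" for \<xi>
        using that False assms True by (auto simp: less_max_iff_disj profile2_def fan2_def)
      show "continuous_on UNIV ?D" by (intro continuous_intros)
    qed (use assms in \<open>auto simp: le_max_iff_disj\<close>)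
    moreover have "?D 0 \<le> rr" using True by auto
    ultimately show ?thesis
      using fl by (simp add: curve_flux_rarefaction[OF assms(1)])
  qed
next
  case m: False
  show ?thesis
  proof (cases "m = rr")
    case True
    then show ?thesis
      using assms by (intro has_edge_flux_const[of 1 _ "(rr, ur)"])
        (auto simp: profile2_def flux_out_def curve_flux_def)
  next
    case False
    with m have m: "rr < m" by simp
    let ?u = "ur + jump rr m"
    have p: "profile2 m (rr, ur) \<xi> = (if \<xi> < shock_speed (m, ?u) (rr, ur) then (m, ?u) else (rr, ur))"
      for \<xi> using m by (simp add: profile2_def)
    have sp: "0 < shock_speed (m, ?u) (rr, ur) \<longleftrightarrow> curve_flux rr ur rr < curve_flux rr ur m"
      using m assms by (simp add: shock_speed_def zero_less_divide_iff curve_flux_def)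
    show ?thesis
    proof (cases "0 < shock_speed (m, ?u) (rr, ur)")
      case True
      then show ?thesis
        using sp m assms
        by (intro has_edge_flux_const[of "shock_speed (m, ?u) (rr, ur)" _ "(m, ?u)"])
          (auto simp: p flux_out_def curve_flux_def)
    next
      case False
      then show ?thesis
        using sp m assms
        by (intro has_edge_flux_const[of 1 _ "(rr, ur)"])
          (auto simp: p flux_out_def curve_flux_def)
    qed
  qed
qed

section \<open>Existence and uniqueness of Lax solutions, with their fluxes\<close>

text \<open>The joining speed is not unique, but between two admissible ones both profiles equal
  \<open>Um\<close>.\<close>

lemma join_profiles_unique:
  assumes "join_profiles Um w1 w2 w" "join_profiles Um w1 w2 w'"
  shows "w = w'"
proof
  fix \<xi>
  obtain \<sigma> \<sigma>' where
    "\<forall>\<xi>\<ge>\<sigma>. w1 \<xi> = Um" "\<forall>\<xi>\<le>\<sigma>. w2 \<xi> = Um" "\<forall>\<xi>. w \<xi> = (if \<xi> \<le> \<sigma> then w1 \<xi> else w2 \<xi>)"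
    "\<forall>\<xi>\<ge>\<sigma>'. w1 \<xi> = Um" "\<forall>\<xi>\<le>\<sigma>'. w2 \<xi> = Um" "\<forall>\<xi>. w' \<xi> = (if \<xi> \<le> \<sigma>' then w1 \<xi> else w2 \<xi>)"
    using assms unfolding join_profiles_def by blast
  then show "w \<xi> = w' \<xi>"
    by (cases "\<xi> \<le> \<sigma>"; cases "\<xi> \<le> \<sigma>'") auto
qed

lemma lax_solution_vacuum_iff: "lax_solution \<kappa> \<gamma> vacuum vacuum w \<longleftrightarrow> w = (\<lambda>_. vacuum)"
  by (auto intro: lax_solution.intros elim: lax_solution.cases)

lemma lax_solution_left_vacuum_iff:
  "0 < rr \<Longrightarrow> lax_solution \<kappa> \<gamma> vacuum (rr, ur) w \<longleftrightarrow> w = profile2 0 (rr, ur)"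
  using rarefaction_from_vacuum_iff[of rr ur w] lax_solution.left_vacuum[of "(rr, ur)" \<kappa> \<gamma> w]
  by (auto elim: lax_solution.cases)

lemma lax_solution_right_vacuum_iff:
  "0 < rl \<Longrightarrow> lax_solution \<kappa> \<gamma> (rl, ul) vacuum w \<longleftrightarrow> w = profile1 (rl, ul) 0"
  using rarefaction_to_vacuum_iff[of rl ul w] lax_solution.right_vacuum[of "(rl, ul)" \<kappa> \<gamma> w]
  by (auto elim: lax_solution.cases)

text \<open>A non-vacuum intermediate state lies on both curves, so its density is the unique root
  of \<open>gap\<close>; the wave relations then fix both profiles.\<close>

lemma lax_solution_iff_join:
  fixes s rr ur :: real
  assumes "0 < s" "0 < rr"
  defines "m \<equiv> mid rr ur s"
  shows "lax_solution \<kappa> \<gamma> (s, 0) (rr, ur) w \<longleftrightarrow>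
    join_profiles (if m = 0 then vacuum else (m, ur + jump rr m))
      (profile1 (s, 0) m) (profile2 m (rr, ur)) w"
    (is "_ \<longleftrightarrow> ?J")
proof -
  have gap0: "0 \<le> gap rr ur s 0 \<longleftrightarrow> vacuum_speed1 \<kappa> \<gamma> (s, 0) \<le> vacuum_speed2 \<kappa> \<gamma> (rr, ur)"
    using assms by (simp add: gap_def vacuum_speed1_def vacuum_speed2_def)
  show ?thesis
  proof (cases "0 \<le> gap rr ur s 0")
    case True
    then have m: "m = 0" by (simp add: m_def mid_eq_0 assms)
    show ?thesis
    proof
      assume "lax_solution \<kappa> \<gamma> (s, 0) (rr, ur) w"
      then show ?J
        by (cases rule: lax_solution.cases)
          (use assms gap0 True m in \<open>auto simp: rarefaction_to_vacuum_iff rarefaction_from_vacuum_iff\<close>)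
    next
      assume ?J
      then show "lax_solution \<kappa> \<gamma> (s, 0) (rr, ur) w"
        using True gap0 m assms
        by (intro lax_solution.middle_vacuum[of _ _ _ _ "profile1 (s, 0) m" "profile2 m (rr, ur)"])
          (auto simp: rarefaction_to_vacuum_iff rarefaction_from_vacuum_iff)
    qed
  next
    case False
    then have m: "0 < m" "gap rr ur s m = 0"
      using mid_root[of rr s ur] assms by auto
    then have u: "ur + jump rr m = - jump s m"
      using assms by (simp add: gap_def)
    show ?thesis
    proof
      assume "lax_solution \<kappa> \<gamma> (s, 0) (rr, ur) w"
      then show ?J
      proof (cases rule: lax_solution.cases)
        case (no_vacuum Um w1 w2)
        obtain m' u' where Um: "Um = (m', u')" by force
        have w: "0 < m'" "u' = 0 - jump s m'" "w1 = profile1 (s, 0) m'"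
          "u' = ur + jump rr m'" "w2 = profile2 m' (rr, ur)"
          using no_vacuum assms wave1_iff[of s 0 m' u' w1] wave2_iff[of rr m' u' ur w2]
          by (auto simp: Um)
        then have "m' = m"
          using mid_eqI[of rr s m' ur] assms by (simp add: gap_def)
        then show ?thesis
          using no_vacuum(6) w m by (simp add: Um)
      qed (use assms gap0 False in auto)
    next
      assume J: ?J
      show "lax_solution \<kappa> \<gamma> (s, 0) (rr, ur) w"
      proof (rule lax_solution.no_vacuum)
        show "wave1 \<kappa> \<gamma> (s, 0) (m, ur + jump rr m) (profile1 (s, 0) m)"
          using assms m u by (simp add: wave1_iff)
        show "wave2 \<kappa> \<gamma> (m, ur + jump rr m) (rr, ur) (profile2 m (rr, ur))"
          using assms m by (simp add: wave2_iff)
      qed (use J m assms gap0 False in auto)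
    qed
  qed
qed

text \<open>\<open>riemann_flux Ur s\<close> is the mass flux at \<open>x = 0+\<close> of the Riemann solution with
  data \<open>(s, 0)\<close> and \<open>Ur\<close>.\<close>

definition riemann_flux :: "state \<Rightarrow> real \<Rightarrow> real" where
  "riemann_flux Ur s = (if fst Ur = 0 then sonic_density s * sonic_velocity s
     else edge_flux (fst Ur) (snd Ur) s)"

definition edge_solution :: "state \<Rightarrow> real \<Rightarrow> (real \<Rightarrow> state) \<Rightarrow> bool" where
  "edge_solution Ur s w \<longleftrightarrow> (\<forall>w'. lax_solution \<kappa> \<gamma> (s, 0) Ur w' \<longleftrightarrow> w' = w) \<and>
     (\<forall>\<xi>. w \<xi> \<in> gas_states) \<and> (\<exists>e. \<forall>\<xi>\<ge>e. w \<xi> = Ur) \<and> has_edge_flux w (riemann_flux Ur s)"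

lemma edge_solution_interior:
  assumes "0 < s" "0 < rr"
  shows "\<exists>w. edge_solution (rr, ur) s w"
proof -
  define m where "m = mid rr ur s"
  define Um where "Um = (if m = 0 then vacuum else (m, ur + jump rr m))"
  let ?w1 = "profile1 (s, 0) m" and ?w2 = "profile2 m (rr, ur)"
  have s0: "0 \<le> s" using assms by simp
  have m_nonneg: "0 \<le> m" using mid_nonneg assms by (simp add: m_def)
  have u: "ur + jump rr m = mid_velocity rr ur s"
    using assms by (simp add: mid_velocity_def m_def)
  have root: "ur + jump rr m = - jump s m" if "m \<noteq> 0"
    by (rule mid_cases[OF assms(2) s0, of ur]) (use that m_def assms in \<open>auto simp: gap_def\<close>)
  have vac: "a * s powr \<theta> \<le> ur - a * rr powr \<theta>" if "m = 0"
    by (rule mid_cases[OF assms(2) s0, of ur]) (use that m_def assms in \<open>auto simp: gap_def\<close>)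
  have as_pos: "0 < a * s powr \<theta>" using assms a_pos by simp
  \<comment> \<open>The witness is the intermediate velocity, which separates the two waves; for
    vacuum it is the right edge of the 1-fan.\<close>
  have "\<exists>\<sigma>. (\<forall>\<xi>\<ge>\<sigma>. ?w1 \<xi> = Um) \<and> (\<forall>\<xi>\<le>\<sigma>. ?w2 \<xi> = Um)"
  proof (cases "m = 0")
    case True
    then show ?thesis
      using vac assms profile1_vacuum[of s 0] profile2_vacuum[of rr _ ur]
      by (intro exI[of _ "a * s powr \<theta>"]) (auto simp: Um_def)
  next
    case False
    then have "0 < m" using m_nonneg by simp
    obtain e where e: "e < 0 - jump s m" "\<And>\<xi>. e \<le> \<xi> \<Longrightarrow> ?w1 \<xi> = (m, 0 - jump s m)"
      using profile1_ge[OF assms(1) \<open>0 < m\<close>] by blast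
    obtain e' where e': "ur + jump rr m < e'" "\<And>\<xi>. \<xi> < e' \<Longrightarrow> ?w2 \<xi> = (m, ur + jump rr m)"
      using profile2_less[OF assms(2) \<open>0 < m\<close>] by blast
    show ?thesis
      using e e' root False by (intro exI[of _ "ur + jump rr m"]) (auto simp: Um_def)
  qed
  then obtain \<sigma> where \<sigma>: "\<And>\<xi>. \<sigma> \<le> \<xi> \<Longrightarrow> ?w1 \<xi> = Um" "\<And>\<xi>. \<xi> \<le> \<sigma> \<Longrightarrow> ?w2 \<xi> = Um" by blast
  define w where "w = (\<lambda>\<xi>. if \<xi> \<le> \<sigma> then ?w1 \<xi> else ?w2 \<xi>)"
  have "join_profiles Um ?w1 ?w2 w"
    unfolding join_profiles_def w_def using \<sigma> by (intro exI[of _ \<sigma>]) auto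
  then have "lax_solution \<kappa> \<gamma> (s, 0) (rr, ur) w' \<longleftrightarrow> w' = w" for w'
    using lax_solution_iff_join[OF assms, of ur w'] join_profiles_unique[of Um ?w1 ?w2 w w']
    unfolding m_def[symmetric] Um_def[symmetric] by blast
  moreover have "w \<xi> \<in> gas_states" for \<xi>
    using profile1_gas[OF assms(1) m_nonneg] profile2_gas[OF assms(2) m_nonneg] by (simp add: w_def)
  moreover have "\<exists>e. \<forall>\<xi>\<ge>e. w \<xi> = (rr, ur)"
  proof -
    obtain e where "\<And>\<xi>. e \<le> \<xi> \<Longrightarrow> ?w2 \<xi> = (rr, ur)"
      using profile2_right_state[OF assms(2) m_nonneg] by blast
    then show ?thesis
      by (intro exI[of _ "max e (\<sigma> + 1)"]) (auto simp: w_def)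
  qed
  moreover have "has_edge_flux w (edge_flux rr ur s)"
  proof (cases "0 \<le> ur + jump rr m")
    case True
    have w1: "has_edge_flux w q" if "has_edge_flux ?w1 q" for q
    proof -
      \<comment> \<open>Until the 2-wave starts, at a positive speed, the joined profile coincides
        with the 1-wave, also beyond the joining speed.\<close>
      have "\<exists>e>0. \<forall>\<xi><e. ?w2 \<xi> = Um"
      proof (cases "m = 0")
        case True
        then show ?thesis
          using vac as_pos profile2_vacuum[of rr _ ur] assms
          by (intro exI[of _ "ur - a * rr powr \<theta>"]) (auto simp: Um_def)
      next
        case False
        then obtain e where "ur + jump rr m < e" "\<And>\<xi>. \<xi> < e \<Longrightarrow> ?w2 \<xi> = (m, ur + jump rr m)"
          using profile2_less[OF assms(2), of m ur] m_nonneg by (metis less_le)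
        then show ?thesis
          using False \<open>0 \<le> ur + jump rr m\<close> by (intro exI[of _ e]) (auto simp: Um_def)
      qed
      then obtain e where e: "0 < e" "\<And>\<xi>. \<xi> < e \<Longrightarrow> ?w2 \<xi> = Um" by blast
      have "w \<xi> = ?w1 \<xi>" if "\<xi> < e" for \<xi>
        using \<sigma> e that by (simp add: w_def)
      then show ?thesis by (rule has_edge_flux_cong[OF that _ e(1)])
    qed
    have ms: "m \<le> s"
      using root True jump_pos[of s m] assms by (cases "m = 0") (auto simp: not_less[symmetric])
    \<comment> \<open>For vacuum the first arguments differ, but both are at least the sonic
      velocity, so the minima agree.\<close>
    have "min (a * s powr \<theta> - a * m powr \<theta>) (sonic_velocity s)
        = min (max 0 (mid_velocity rr ur s)) (sonic_velocity s)"
    proof (cases "m = 0")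
      case m0: True
      have "sonic_velocity s \<le> a * s powr \<theta>"
        using a_pos by (simp add: sonic_velocity_def)
      moreover have "a * s powr \<theta> \<le> mid_velocity rr ur s"
        using vac[OF m0] m0 u assms by simp
      ultimately show ?thesis
        using m0 theta_pos as_pos by simp
    next
      case False
      then show ?thesis
        using root[OF False] True ms u by (simp add: jump_def algebra_simps)
    qed
    then have "has_edge_flux ?w1 (flux_in rr ur s)"
      using profile1_edge_flux[OF assms(1) m_nonneg ms] assms
      by (simp add: flux_in_def m_def)
    then show ?thesis
      using w1 edge_flux_nonneg[OF assms(2) s0, of ur] True u by simp
  next
    case False
    then have "m \<noteq> 0" using vac as_pos assms by (cases "m = 0") auto
    then have "0 < m" using m_nonneg by simp
    obtain e where e: "e < 0 - jump s m" "\<And>\<xi>. e \<le> \<xi> \<Longrightarrow> ?w1 \<xi> = (m, 0 - jump s m)"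
      using profile1_ge[OF assms(1) \<open>0 < m\<close>] by blast
    then have "?w1 \<xi> = Um" if "0 < \<xi>" for \<xi>
      using that root[OF \<open>m \<noteq> 0\<close>] \<open>m \<noteq> 0\<close> False by (simp add: Um_def)
    then have "w \<xi> = ?w2 \<xi>" if "0 < \<xi>" for \<xi>
      using \<sigma> that by (simp add: w_def)
    then have "has_edge_flux w (flux_out rr ur m)"
      by (rule has_edge_flux_cong[OF profile2_edge_flux[OF assms(2) m_nonneg] _ zero_less_one])
    then show ?thesis
      using edge_flux_neg[OF assms(2) s0, of ur] False u by (simp add: m_def)
  qed
  ultimately show ?thesis
    unfolding edge_solution_def riemann_flux_def using assms by (intro exI[of _ w]) auto
qed

lemma edge_solution_exists:
  assumes "0 \<le> s" "Ur \<in> gas_states"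
  shows "\<exists>w. edge_solution Ur s w"
proof -
  obtain rr ur where Ur: "Ur = (rr, ur)" by force
  consider "rr = 0" "ur = 0" "s = 0" | "rr = 0" "ur = 0" "0 < s" | "0 < rr" "s = 0" | "0 < rr" "0 < s"
    using assms by (cases "s = 0") (auto simp: gas_states_def Ur)
  then show ?thesis
  proof cases
    case 1
    then have "edge_solution Ur s (\<lambda>_. vacuum)"
      by (auto simp: edge_solution_def Ur lax_solution_vacuum_iff gas_states_def riemann_flux_def
          intro!: has_edge_flux_const[of 1])
    then show ?thesis by blast
  next
    case 2
    have "0 \<le> a * s powr \<theta>" using a_pos by simp
    moreover have "sonic_velocity s \<le> a * s powr \<theta>"
      using a_pos by (simp add: sonic_velocity_def)
    ultimately have "has_edge_flux (profile1 (s, 0) 0) (sonic_density s * sonic_velocity s)"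
      using profile1_edge_flux[of s 0] 2 theta_pos by (simp add: min_absorb2)
    moreover have "\<forall>\<xi>\<ge>a * s powr \<theta>. profile1 (s, 0) 0 \<xi> = vacuum"
      using profile1_vacuum[of s 0] 2 by simp
    ultimately have "edge_solution Ur s (profile1 (s, 0) 0)"
      using 2 lax_solution_right_vacuum_iff[of s 0] profile1_gas[of s 0 0]
      by (auto simp: edge_solution_def Ur riemann_flux_def)
    then show ?thesis by blast
  next
    case 3
    \<comment> \<open>Only the 2-fan from vacuum is present: \<open>flux_in\<close> vanishes at
      \<open>s = 0\<close> and \<open>flux_out\<close> is nonpositive at vacuum.\<close>
    have "edge_flux rr ur 0 = flux_out rr ur 0"
    proof (cases "0 \<le> mid_velocity rr ur 0")
      case True
      have v: "0 \<le> ur - a * rr powr \<theta>"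
        using True 3 by (simp add: mid_velocity_def mid_eq_0)
      then have "sonic (a * rr powr \<theta> - ur) = 0"
        by (intro sonic_eq_0) simp
      then have "flux_out rr ur 0 = 0"
        using 3 by (simp add: flux_out_def curve_flux_def)
      then show ?thesis
        using edge_flux_nonneg[OF 3(1) _ True] 3 by (simp add: flux_in_def mid_eq_0)
    next
      case False
      then show ?thesis
        using edge_flux_neg[OF 3(1), of 0 ur] 3 by (simp add: mid_eq_0)
    qed
    then have "has_edge_flux (profile2 0 (rr, ur)) (edge_flux rr ur 0)"
      using profile2_edge_flux[OF 3(1), of 0] by simp
    moreover obtain e where "\<And>\<xi>. e \<le> \<xi> \<Longrightarrow> profile2 0 (rr, ur) \<xi> = (rr, ur)"
      using profile2_right_state[OF 3(1), of 0] by blast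
    ultimately have "edge_solution Ur s (profile2 0 (rr, ur))"
      using 3 lax_solution_left_vacuum_iff[of rr ur] profile2_gas[of rr 0 ur]
      by (auto simp: edge_solution_def Ur riemann_flux_def)
    then show ?thesis by blast
  next
    case 4
    then show ?thesis using edge_solution_interior Ur by simp
  qed
qed

section \<open>Monotonicity and continuity of the flux for all right states\<close>

lemma gas_state_cases:
  assumes "Ur \<in> gas_states"
  obtains "fst Ur = 0" "Ur = vacuum" | "0 < fst Ur"
  using assms by (auto simp: gas_states_def)

lemma riemann_flux_0: "Ur \<in> gas_states \<Longrightarrow> riemann_flux Ur 0 \<le> 0"
  by (erule gas_state_cases) (auto simp: riemann_flux_def edge_flux_0)

lemma riemann_flux_strict_mono:
  assumes "Ur \<in> gas_states" "0 \<le> s" "s < s'" "0 \<le> riemann_flux Ur s"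
  shows "riemann_flux Ur s < riemann_flux Ur s'"
  using assms(1)
proof (cases rule: gas_state_cases)
  case 1
  then show ?thesis
    using assms sonic_density_strict_mono[of s s'] sonic_velocity_strict_mono[of s s']
      sonic_velocity_nonneg[of s]
    by (auto simp: riemann_flux_def intro!: mult_strict_mono')
next
  case 2
  then show ?thesis
    using assms edge_flux_strict_mono[of "fst Ur" s s' "snd Ur"] by (simp add: riemann_flux_def)
qed

lemma riemann_flux_mono:
  assumes "Ur \<in> gas_states" "0 \<le> s" "s \<le> s'"
  shows "riemann_flux Ur s \<le> riemann_flux Ur s'"
  using assms(1)
proof (cases rule: gas_state_cases)
  case 1
  then have "0 \<le> riemann_flux Ur s"
    using sonic_velocity_nonneg[of s] by (simp add: riemann_flux_def)
  then show ?thesis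
    using riemann_flux_strict_mono[of Ur s s'] assms by (cases "s = s'") auto
next
  case 2
  then show ?thesis
    using assms edge_flux_mono[of "fst Ur" s s' "snd Ur"] by (simp add: riemann_flux_def)
qed

lemma continuous_on_riemann_flux:
  assumes "Ur \<in> gas_states"
  shows "continuous_on {0..} (riemann_flux Ur)"
  using assms
proof (cases rule: gas_state_cases)
  case 1
  then show ?thesis
    unfolding riemann_flux_def
    by (simp add: continuous_on_mult continuous_on_sonic_density continuous_on_sonic_velocity)
next
  case 2
  then show ?thesis
    unfolding riemann_flux_def using continuous_on_edge_flux[of "fst Ur" "snd Ur"] by simp
qed

lemma riemann_flux_nonneg_large:
  assumes "Ur \<in> gas_states"
  shows "\<exists>S. \<forall>s\<ge>S. 0 \<le> riemann_flux Ur s"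
  using assms
proof (cases rule: gas_state_cases)
  case 1
  then show ?thesis
    using sonic_velocity_nonneg by (simp add: riemann_flux_def)
next
  case 2
  then show ?thesis
    using edge_flux_nonneg_large[OF 2, of "snd Ur"] by (simp add: riemann_flux_def)
qed

definition riemann :: "state \<Rightarrow> real \<Rightarrow> real \<Rightarrow> state" where
  "riemann Ur s = (SOME w. edge_solution Ur s w)"

lemma edge_solution_riemann: "0 \<le> s \<Longrightarrow> Ur \<in> gas_states \<Longrightarrow> edge_solution Ur s (riemann Ur s)"
  unfolding riemann_def using edge_solution_exists by (rule someI_ex)

end

section \<open>The junction: reduction to the total flux and its zero\<close>

locale junction = isentropic_gas +
  fixes d :: nat and A :: "nat \<Rightarrow> real" and Uinit :: "nat \<Rightarrow> state"
  assumes d_pos: "1 \<le> d"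
    and A_pos: "\<And>k. k \<in> {1..d} \<Longrightarrow> 0 < A k"
    and Uinit_gas: "\<And>k. k \<in> {1..d} \<Longrightarrow> Uinit k \<in> gas_states"
begin

definition total_flux :: "real \<Rightarrow> real" where
  "total_flux s = (\<Sum>k=1..d. A k * riemann_flux (Uinit k) s)"

lemma total_flux_root: "\<exists>s\<ge>0. total_flux s = 0"
proof -
  have "\<forall>k\<in>{1..d}. \<exists>S. \<forall>s\<ge>S. 0 \<le> riemann_flux (Uinit k) s"
    using riemann_flux_nonneg_large Uinit_gas by blast
  then obtain S where S: "\<And>k s. k \<in> {1..d} \<Longrightarrow> S k \<le> s \<Longrightarrow> 0 \<le> riemann_flux (Uinit k) s"
    by metis
  define s1 where "s1 = Max (insert 0 (S ` {1..d}))"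
  have s1: "0 \<le> s1" "\<And>k. k \<in> {1..d} \<Longrightarrow> S k \<le> s1"
    unfolding s1_def by (intro Max_ge; auto)+
  have "0 \<le> total_flux s1"
    unfolding total_flux_def using S s1 A_pos by (intro sum_nonneg mult_nonneg_nonneg) (auto intro: less_imp_le)
  moreover have "total_flux 0 \<le> 0"
    unfolding total_flux_def
    using riemann_flux_0 Uinit_gas A_pos by (intro sum_nonpos mult_nonneg_nonpos) (auto intro: less_imp_le)
  moreover have "continuous_on {0..s1} total_flux"
    unfolding total_flux_def
    using Uinit_gas
    by (intro continuous_intros continuous_on_subset[OF continuous_on_riemann_flux]) auto
  ultimately show ?thesis
    using IVT'[of total_flux 0 0 s1] s1 by blast
qed

lemma total_flux_less:
  assumes "0 \<le> s" "s < s'" "total_flux s = 0"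
  shows "0 < total_flux s'"
proof -
  have "\<exists>j\<in>{1..d}. 0 \<le> A j * riemann_flux (Uinit j) s"
  proof (rule ccontr)
    assume "\<not> ?thesis"
    then have "total_flux s < (\<Sum>k=1..d. 0)"
      unfolding total_flux_def using d_pos by (intro sum_strict_mono) (auto simp: not_le)
    with assms show False by simp
  qed
  then obtain j where j: "j \<in> {1..d}" "0 \<le> riemann_flux (Uinit j) s"
    using A_pos by (force simp: zero_le_mult_iff)
  have "total_flux s < total_flux s'"
    unfolding total_flux_def
  proof (rule sum_strict_mono_ex1)
    show "\<forall>k\<in>{1..d}. A k * riemann_flux (Uinit k) s \<le> A k * riemann_flux (Uinit k) s'"
      using riemann_flux_mono Uinit_gas A_pos assms by (auto intro!: mult_left_mono less_imp_le)
    show "\<exists>k\<in>{1..d}. A k * riemann_flux (Uinit k) s < A k * riemann_flux (Uinit k) s'"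
      using riemann_flux_strict_mono Uinit_gas A_pos assms j by (intro bexI[of _ j]) auto
  qed auto
  with assms show ?thesis by simp
qed

lemma total_flux_root_unique:
  "0 \<le> s \<Longrightarrow> 0 \<le> s' \<Longrightarrow> total_flux s = 0 \<Longrightarrow> total_flux s' = 0 \<Longrightarrow> s = s'"
  using total_flux_less[of s s'] total_flux_less[of s' s] by linarith

lemma artificial_density_iff:
  "artificial_density \<kappa> \<gamma> d Uinit U s \<longleftrightarrow> 0 \<le> s \<and>
     (\<forall>k\<in>{1..d}. \<forall>t>0. \<forall>x>0. U k (t, x) = riemann (Uinit k) s (x / t))"
proof (cases "0 \<le> s")
  case True
  then have "lax_solution \<kappa> \<gamma> (s, 0) (Uinit k) w \<longleftrightarrow> w = riemann (Uinit k) s" if "k \<in> {1..d}" for k w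
    using edge_solution_riemann[of s "Uinit k"] Uinit_gas[OF that] unfolding edge_solution_def by blast
  then show ?thesis
    using True by (simp add: artificial_density_def)
qed (simp add: artificial_density_def)

text \<open>By self-similarity the trace exists for every positive time and does not depend on it,
  so any admissible \<open>Ubar\<close> must be this trace.\<close>

lemma conserves_mass_iff:
  assumes U: "artificial_density \<kappa> \<gamma> d Uinit U s"
  shows "conserves_mass d A U \<longleftrightarrow> total_flux s = 0"
proof -
  have s: "0 \<le> s" using U by (simp add: artificial_density_iff)
  have "\<exists>V. (riemann (Uinit k) s \<longlongrightarrow> V) (at_right 0) \<and> fst V * snd V = riemann_flux (Uinit k) s"
    if "k \<in> {1..d}" for k
    using edge_solution_riemann[OF s, of "Uinit k"] Uinit_gas[OF that]
    by (simp add: edge_solution_def has_edge_flux_def)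
  then obtain V where V: "\<And>k. k \<in> {1..d} \<Longrightarrow> (riemann (Uinit k) s \<longlongrightarrow> V k) (at_right 0)"
    "\<And>k. k \<in> {1..d} \<Longrightarrow> fst (V k) * snd (V k) = riemann_flux (Uinit k) s"
    by metis
  have lim: "((\<lambda>x. U k (t, x)) \<longlongrightarrow> V k) (at_right 0)" if k: "k \<in> {1..d}" and t: "0 < t" for k t
  proof -
    have "filterlim (\<lambda>x. x / t) (at_right 0) (at_right 0)"
      unfolding filterlim_at
    proof
      show "\<forall>\<^sub>F x in at_right 0. x / t \<in> {0<..} \<and> x / t \<noteq> 0"
        using t by (auto simp: eventually_at_filter)
      show "((\<lambda>x. x / t) \<longlongrightarrow> 0) (at_right 0)"
        using t by (auto intro!: tendsto_eq_intros)
    qed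
    then have "((\<lambda>x. riemann (Uinit k) s (x / t)) \<longlongrightarrow> V k) (at_right 0)"
      by (rule filterlim_compose[OF V(1)[OF k]])
    moreover have "\<forall>\<^sub>F x in at_right 0. U k (t, x) = riemann (Uinit k) s (x / t)"
      using U k t by (auto simp: artificial_density_iff eventually_at_filter)
    ultimately show ?thesis
      by (simp add: tendsto_cong)
  qed
  have sum: "(\<Sum>k=1..d. A k * fst (V k) * snd (V k)) = total_flux s"
    unfolding total_flux_def using V(2) by (intro sum.cong) (auto simp: mult.assoc)
  show ?thesis
  proof
    assume "conserves_mass d A U"
    then obtain Ubar where Ubar:
      "\<forall>k\<in>{1..d}. AE t in lborel. 0 < t \<longrightarrow> ((\<lambda>x. U k (t, x)) \<longlongrightarrow> Ubar k) (at_right 0)"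
      "(\<Sum>k=1..d. A k * fst (Ubar k) * snd (Ubar k)) = 0"
      unfolding conserves_mass_def by blast
    have "Ubar k = V k" if k: "k \<in> {1..d}" for k
    proof -
      \<comment> \<open>An almost-everywhere statement yields at least one time, since the unit
        interval is not a null set.\<close>
      have "\<exists>t>0. ((\<lambda>x. U k (t, x)) \<longlongrightarrow> Ubar k) (at_right 0)"
      proof (rule ccontr)
        assume "\<not> ?thesis"
        then have "AE t in lborel. (t::real) \<notin> {0<..<1}"
          using Ubar(1)[rule_format, OF k] by (auto elim: eventually_mono)
        then have "{0<..<1::real} \<in> null_sets lborel"
          by (subst AE_iff_null_sets) auto
        then show False by (auto dest: null_setsD1)
      qed
      then show ?thesis
        using lim[OF k] tendsto_unique trivial_limit_at_right_real by blast
    qed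
    with Ubar(2) sum show "total_flux s = 0" by simp
  next
    assume "total_flux s = 0"
    then show "conserves_mass d A U"
      unfolding conserves_mass_def using lim sum by (intro exI[of _ V]) auto
  qed
qed

lemma grp_solution_exists: "\<exists>U. grp_solution \<kappa> \<gamma> d A Uinit U"
proof -
  obtain s where s: "0 \<le> s" "total_flux s = 0"
    using total_flux_root by blast
  define U where "U = (\<lambda>k\<in>{1..d}. \<lambda>p\<in>{0<..} \<times> {0<..}. riemann (Uinit k) s (snd p / fst p))"
  have U: "U k (t, x) = riemann (Uinit k) s (x / t)" if "k \<in> {1..d}" "0 < t" "0 < x" for k t x
    using that by (simp add: U_def)
  then have ad: "artificial_density \<kappa> \<gamma> d Uinit U s"
    using s by (simp add: artificial_density_iff)
  have R: "edge_solution (Uinit k) s (riemann (Uinit k) s)" if "k \<in> {1..d}" for k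
    using that s Uinit_gas by (intro edge_solution_riemann)
  have "U \<in> grp_functions d"
    unfolding grp_functions_def U_def using R by (auto simp: edge_solution_def)
  moreover have "attains_initial_data d Uinit U"
    unfolding attains_initial_data_def
  proof (intro ballI allI impI)
    fix k x assume k: "k \<in> {1..d}" and x: "0 < (x::real)"
    obtain e where e: "\<And>\<xi>. e \<le> \<xi> \<Longrightarrow> riemann (Uinit k) s \<xi> = Uinit k"
      using R[OF k] unfolding edge_solution_def by blast
    have "\<forall>\<^sub>F t in at_right 0. t \<in> {0<..<x / max e 1}"
      using x by (intro eventually_at_right_real) auto
    then have "\<forall>\<^sub>F t in at_right 0. U k (t, x) = Uinit k"
    proof eventually_elim
      case (elim t)
      then have "t * max e 1 < x" by (simp add: pos_less_divide_eq)
      then have "max e 1 < x / t"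
        using elim by (subst pos_less_divide_eq) (auto simp: mult.commute)
      then show ?case using elim U[OF k _ x] e by simp
    qed
    then show "((\<lambda>t. U k (t, x)) \<longlongrightarrow> Uinit k) (at_right 0)"
      by (rule tendsto_eventually)
  qed
  ultimately show ?thesis
    using ad conserves_mass_iff[OF ad] s unfolding grp_solution_def by blast
qed

lemma grp_solution_density:
  assumes "grp_solution \<kappa> \<gamma> d A Uinit U" "artificial_density \<kappa> \<gamma> d Uinit U s"
  shows "0 \<le> s" "total_flux s = 0"
  using assms conserves_mass_iff[OF assms(2)] by (auto simp: grp_solution_def artificial_density_iff)

lemma grp_solution_unique:
  assumes "grp_solution \<kappa> \<gamma> d A Uinit U" "grp_solution \<kappa> \<gamma> d A Uinit U'"
  shows "U = U'"
proof -
  obtain s s' where s: "artificial_density \<kappa> \<gamma> d Uinit U s" "artificial_density \<kappa> \<gamma> d Uinit U' s'"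
    using assms unfolding grp_solution_def by blast
  then have "s' = s"
    using grp_solution_density assms total_flux_root_unique by blast
  then have eq: "U k (t, x) = U' k (t, x)" if "k \<in> {1..d}" "0 < t" "0 < x" for k t x
    using s that by (simp add: artificial_density_iff)
  have F: "U \<in> grp_functions d" "U' \<in> grp_functions d"
    using assms by (auto simp: grp_solution_def)
  show ?thesis
  \<comment> \<open>Outside the index range and the quadrant both families are undefined in the
    extensional sense, so agreement inside suffices.\<close>
  proof (rule PiE_ext[OF F[unfolded grp_functions_def]])
    fix k assume k: "k \<in> {1..d}"
    show "U k = U' k"
    proof (rule PiE_ext)
      show "U k \<in> ({0<..} \<times> {0<..}) \<rightarrow>\<^sub>E gas_states" "U' k \<in> ({0<..} \<times> {0<..}) \<rightarrow>\<^sub>E gas_states"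
        using F k unfolding grp_functions_def by (blast dest: PiE_mem)+
      fix p :: "real \<times> real" assume "p \<in> {0<..} \<times> {0<..}"
      then show "U k p = U' k p"
        using eq[OF k, of "fst p" "snd p"] by (simp add: mem_Times_iff)
    qed
  qed
qed

end

theorem theorem2:
  fixes \<kappa> \<gamma> :: real and d :: nat and A :: "nat \<Rightarrow> real" and Uinit :: "nat \<Rightarrow> state"
  assumes "\<kappa> > 0" and "1 < \<gamma>" and "\<gamma> < 3" and "d \<ge> 1"
    and "\<And>k. k \<in> {1..d} \<Longrightarrow> A k > 0"
    and "\<And>k. k \<in> {1..d} \<Longrightarrow> Uinit k \<in> gas_states"
  shows "(\<exists>!U. grp_solution \<kappa> \<gamma> d A Uinit U) \<and>
         (\<forall>U. grp_solution \<kappa> \<gamma> d A Uinit U \<longrightarrow>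
              (\<exists>!\<rho>s. artificial_density \<kappa> \<gamma> d Uinit U \<rho>s))"
proof -
  interpret junction \<kappa> \<gamma> d A Uinit
    using assms by unfold_locales auto
  show ?thesis
  proof (intro conjI allI impI)
    show "\<exists>!U. grp_solution \<kappa> \<gamma> d A Uinit U"
      using grp_solution_exists grp_solution_unique by blast
    fix U assume U: "grp_solution \<kappa> \<gamma> d A Uinit U"
    then have "\<exists>\<rho>s. artificial_density \<kappa> \<gamma> d Uinit U \<rho>s"
      by (simp add: grp_solution_def)
    then show "\<exists>!\<rho>s. artificial_density \<kappa> \<gamma> d Uinit U \<rho>s"
      using grp_solution_density[OF U] total_flux_root_unique by blast
  qed
qed

end
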